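(* Consider the Pólya–Friedman mixed urn model with parameters $a,b,c,p$ and initial composition $(Y^1_0,Y^2_0)$, as described in the context, where $Y^1_0,Y^2_0$ are non-negative integers with $T_0:=Y^1_0+Y^2_0>0$, $a,b,c$ are positive integers and $p\in(0,1)$. Let $Z_n=Y^1_n/T_n$ be the proportion of balls of type $1$ after $n$ draws. If $3bp+cp>ap+c$, then, as $n\to\infty$, $$\sqrt{n}\left(Z_n-\tfrac12\right)\longrightarrow \mathcal{N}\!\left(0,\frac{\sigma^2}{2\Gamma-1}\right)\quad\text{in distribution},$$ where $$\sigma^2:=\frac{p(a-b)^2+c^2(1-p)}{4\big((a+b)p+c(1-p)\big)^2},\qquad \Gamma:=\frac{2bp}{(a+b)p+c(1-p)}.$$
   Context: Pólya–Friedman mixed urn model. An urn contains balls of two types, type $1$ and type $2$. Let $Y^1_n,Y^2_n$ be the numbers of balls of type $1$ and type $2$ after $n$ draws, $T_n:=Y^1_n+Y^2_n$ the total number of balls, $Z_n:=Y^1_n/T_n$, and $\mathcal{F}_n$ the $\sigma$-algebra generated by the first $n$ steps. At each step a ball is drawn uniformly at random, its type is observed, and it is returned. Then, with probability $p$ (independently of the past and of the drawn type), the Friedman rule is applied: $a$ balls of the drawn type and $b$ balls of the opposite type are added; with probability $1-p$ the Pólya rule is applied: $c$ balls of the drawn type are added. Formally, $(\xi_n)_{n\ge1}$ are i.i.d. with $\mathbb{P}(\xi_n=1)=p$, $\mathbb{P}(\xi_n=0)=1-p$, with $\xi_{n+1}$ independent of $\mathcal{F}_n$; $\eta_{n+1}\in\{0,1\}$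 satisfies $\mathbb{P}(\eta_{n+1}=1\mid\mathcal{F}_n)=Z_n$; and $\xi_{n+1},\eta_{n+1}$ are conditionally independent given $\mathcal{F}_n$. The increments are $$\Delta Y^1_{n+1}:=Y^1_{n+1}-Y^1_n=a\mathbf{1}_{\{\xi_{n+1}=1,\eta_{n+1}=1\}}+b\mathbf{1}_{\{\xi_{n+1}=1,\eta_{n+1}=0\}}+c\mathbf{1}_{\{\xi_{n+1}=0,\eta_{n+1}=1\}},$$ $$\Delta T_{n+1}:=T_{n+1}-T_n=(a+b)\mathbf{1}_{\{\xi_{n+1}=1\}}+c\mathbf{1}_{\{\xi_{n+1}=0\}}.$$ $\mathcal{N}(0,s)$ denotes the normal distribution with mean $0$ and variance $s$. *)

theory Defs
  imports "HOL-Probability.Probability"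
begin

definition urn_total :: "(nat \<Rightarrow> 'a \<Rightarrow> nat) \<Rightarrow> (nat \<Rightarrow> 'a \<Rightarrow> nat) \<Rightarrow> nat \<Rightarrow> 'a \<Rightarrow> nat" where
  "urn_total Y1 Y2 n \<omega> = Y1 n \<omega> + Y2 n \<omega>"

definition urn_proportion :: "(nat \<Rightarrow> 'a \<Rightarrow> nat) \<Rightarrow> (nat \<Rightarrow> 'a \<Rightarrow> nat) \<Rightarrow> nat \<Rightarrow> 'a \<Rightarrow> real" where
  "urn_proportion Y1 Y2 n \<omega> = real (Y1 n \<omega>) / real (urn_total Y1 Y2 n \<omega>)"

(* Step k consists of the pair (xi k, eta k), k = 1, 2, ...; the index 0 is not used.
   The initial composition is deterministic, so it adds nothing to the sigma-algebra. *)
definition urn_history ::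
  "'a measure \<Rightarrow> (nat \<Rightarrow> 'a \<Rightarrow> nat) \<Rightarrow> (nat \<Rightarrow> 'a \<Rightarrow> nat) \<Rightarrow> nat \<Rightarrow> 'a measure" where
  "urn_history M \<xi> \<eta> n =
     sigma (space M)
       ({\<xi> k -` A \<inter> space M | k A. k \<in> {1..n}} \<union> {\<eta> k -` A \<inter> space M | k A. k \<in> {1..n}})"

definition cond_prob_alg :: "'a measure \<Rightarrow> 'a measure \<Rightarrow> 'a set \<Rightarrow> 'a \<Rightarrow> real" where
  "cond_prob_alg M F A = real_cond_exp M F (indicat_real A)"

definition cond_indep_var ::
  "'a measure \<Rightarrow> 'a measure \<Rightarrow> 'b measure \<Rightarrow> ('a \<Rightarrow> 'b) \<Rightarrow> 'c measure \<Rightarrow> ('a \<Rightarrow> 'c) \<Rightarrow> bool" where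
  "cond_indep_var M F S X T Y \<longleftrightarrow>
     X \<in> measurable M S \<and> Y \<in> measurable M T \<and>
     (\<forall>A\<in>sets S. \<forall>B\<in>sets T. AE \<omega> in M.
        cond_prob_alg M F ((X -` A \<inter> space M) \<inter> (Y -` B \<inter> space M)) \<omega> =
        cond_prob_alg M F (X -` A \<inter> space M) \<omega> * cond_prob_alg M F (Y -` B \<inter> space M) \<omega>)"

(* xi n = 1: the Friedman rule is applied in step n; xi n = 0: the Polya rule is applied.
   eta n = 1: the ball drawn in step n has type 1; eta n = 0: it has type 2. *)
locale polya_friedman_urn = prob_space M
  for M :: "'a measure"
    and a b c :: nat and p :: real
    and y1 y2 :: nat
    and \<xi> \<eta> :: "nat \<Rightarrow> 'a \<Rightarrow> nat"
    and Y1 Y2 :: "nat \<Rightarrow> 'a \<Rightarrow> nat" +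
  assumes Y1_0: "\<And>\<omega>. \<omega> \<in> space M \<Longrightarrow> Y1 0 \<omega> = y1"
    and Y2_0: "\<And>\<omega>. \<omega> \<in> space M \<Longrightarrow> Y2 0 \<omega> = y2"
    and Y1_Suc: "\<And>n \<omega>. \<omega> \<in> space M \<Longrightarrow>
          Y1 (Suc n) \<omega> = Y1 n \<omega>
            + a * of_bool (\<xi> (Suc n) \<omega> = 1 \<and> \<eta> (Suc n) \<omega> = 1)
            + b * of_bool (\<xi> (Suc n) \<omega> = 1 \<and> \<eta> (Suc n) \<omega> = 0)
            + c * of_bool (\<xi> (Suc n) \<omega> = 0 \<and> \<eta> (Suc n) \<omega> = 1)"
    and T_Suc: "\<And>n \<omega>. \<omega> \<in> space M \<Longrightarrow>
          urn_total Y1 Y2 (Suc n) \<omega> = urn_total Y1 Y2 n \<omega>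
            + (a + b) * of_bool (\<xi> (Suc n) \<omega> = 1) + c * of_bool (\<xi> (Suc n) \<omega> = 0)"
    and xi_indep: "indep_vars (\<lambda>_. count_space UNIV) \<xi> {1..}"
    and xi_1: "\<And>n. prob {\<omega> \<in> space M. \<xi> (Suc n) \<omega> = 1} = p"
    and xi_0: "\<And>n. prob {\<omega> \<in> space M. \<xi> (Suc n) \<omega> = 0} = 1 - p"
    and xi_indep_history: "\<And>n. indep_set
          {\<xi> (Suc n) -` A \<inter> space M | A. A \<in> sets (count_space UNIV)}
          (sets (urn_history M \<xi> \<eta> n))"
    and eta_measurable: "\<And>n. \<eta> (Suc n) \<in> measurable M (count_space UNIV)"
    and eta_range: "\<And>n \<omega>. \<omega> \<in> space M \<Longrightarrow> \<eta> (Suc n) \<omega> \<in> {0, 1}"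
    and eta_cond_prob: "\<And>n. AE \<omega> in M.
          cond_prob_alg M (urn_history M \<xi> \<eta> n) {\<omega> \<in> space M. \<eta> (Suc n) \<omega> = 1} \<omega>
            = urn_proportion Y1 Y2 n \<omega>"
    and xi_eta_cond_indep: "\<And>n.
          cond_indep_var M (urn_history M \<xi> \<eta> n)
            (count_space UNIV) (\<xi> (Suc n)) (count_space UNIV) (\<eta> (Suc n))"

end

(* Put D = Y1 - Y2, T = Y1 + Y2, m = (a + b) p + c (1 - p) and rho = (p (a - b) + (1 - p) c) / m, so
   that Gamma = 1 - rho.  Conditionally on the past, E (exp (i x D_{n+1})) is
   exp (i x D_n) (1 + i x rho m D_n / T_n - s x^2 / 2 + O(|x|^3)) with s = p (a - b)^2 + (1 - p) c^2.
   As E (T_n - m n)^2 and, for rho < 1/2, E D_n^2 are O(n), the random factor m / T_n may be replaced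
   by 1 / (n + 1), so the characteristic functions satisfy
     phi_{n+1}(x) = exp (- s x^2 / 2) phi_n (x (1 + rho / (n + 1))) + O(|x|^3 + |x| / (n + 1)).
   Unrolling this recursion at x = t / sqrt n gives phi_n (t / sqrt n) --> exp (- s t^2 / (2 (1 - 2 rho))),
   and Z_n - 1/2 = D_n / (2 T_n) differs from D_n / (2 m n) by O(1/n) in mean.  Levy's
   continuity theorem concludes. *)
theory Submission
  imports Defs "HOL-Real_Asymp.Real_Asymp"
begin

section \<open>Sequences with linear growth recursions\<close>

text \<open>Passing from \<open>Y1\<close> to the difference D removes the main obstacle: an
  increment of D is plus or minus a - b, or plus or minus c, so its conditional second moment does
  not depend on the composition of the urn, and the Gaussian factor of each step is deterministic.
  The only randomness left in the recursion is the rate m / T_n, and T is a random walk driven by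
  \<open>\<xi>\<close> alone. Replacing the rate by 1 / (n + 1) is affordable because |D| is at most
  T and T_n is almost surely at least n + 1: the error is a product of D_n and T_n - m (n + 1)
  divided by (n + 1)^2, hence controlled by second moments. The hypothesis of the theorem is rho <
  1/2 with denominators cleared. It keeps E D_n^2 linear in n, and it makes the products of the
  factors 1 + rho / (k + 1) grow slower than sqrt n, so that the accumulated errors vanish at x = t
  / sqrt n.\<close>

lemma sublinear_of_recursion:
  fixes e :: "nat \<Rightarrow> real" and \<theta> C :: real
  assumes nonneg: "\<And>n. 0 \<le> e n"
    and \<theta>: "0 < \<theta>" "\<theta> < 1" and C: "0 \<le> C"
    and step: "eventually (\<lambda>n. e (Suc n) \<le> (1 + \<theta> / (real n + 1)) * e n + C / (real n + 1)) sequentially"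
  shows "(\<lambda>n. e n / real n) \<longlonglongrightarrow> 0"
proof -
  \<comment> \<open>any exponent strictly between \<open>\<theta>\<close> and 1 makes a multiple of \<open>(n + 1) powr \<kappa>\<close> a supersolution\<close>
  define \<kappa> where "\<kappa> = (1 + \<theta>) / 2"
  have \<kappa>: "\<theta> < \<kappa>" "\<kappa> < 1" "0 < \<kappa>" using \<theta> by (auto simp: \<kappa>_def)
  have "eventually (\<lambda>n. (1 + \<theta> / (real n + 1)) * (real n + 1) powr \<kappa> + C / (real n + 1)
      \<le> (real n + 2) powr \<kappa>) sequentially"
  proof -
    have "0 < \<kappa> - \<theta>" using \<kappa> by simp
    \<comment> \<open>The bracket is about (\<kappa> - \<theta>) x^(\<kappa> - 1), so after
      multiplication by x + 1 it outgrows every constant, in particular \<open>C\<close>.\<close>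
    have "filterlim (\<lambda>x::real. (x + 1) * ((x + 2) powr \<kappa> - (1 + \<theta> / (x + 1)) * (x + 1) powr \<kappa>)) at_top at_top"
      using \<kappa> \<open>0 < \<kappa> - \<theta>\<close> by real_asymp
    hence "filterlim (\<lambda>n. (real n + 1) * ((real n + 2) powr \<kappa> - (1 + \<theta> / (real n + 1)) * (real n + 1) powr \<kappa>)) at_top sequentially"
      by (rule filterlim_compose[OF _ filterlim_real_sequentially])
    hence "eventually (\<lambda>n. C \<le> (real n + 1) * ((real n + 2) powr \<kappa> - (1 + \<theta> / (real n + 1)) * (real n + 1) powr \<kappa>)) sequentially"
      by (auto simp: filterlim_at_top)
    thus ?thesis
    proof eventually_elim
      case (elim n)
      hence "C / (real n + 1) \<le> (real n + 2) powr \<kappa> - (1 + \<theta> / (real n + 1)) * (real n + 1) powr \<kappa>"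
        by (simp add: divide_le_eq mult.commute)
      thus ?case by linarith
    qed
  qed
  with step have "eventually (\<lambda>n. e (Suc n) \<le> (1 + \<theta> / (real n + 1)) * e n + C / (real n + 1) \<and>
      (1 + \<theta> / (real n + 1)) * (real n + 1) powr \<kappa> + C / (real n + 1) \<le> (real n + 2) powr \<kappa>) sequentially"
    by eventually_elim simp
  then obtain N where N: "\<And>n. n \<ge> N \<Longrightarrow> e (Suc n) \<le> (1 + \<theta> / (real n + 1)) * e n + C / (real n + 1)"
    "\<And>n. n \<ge> N \<Longrightarrow> (1 + \<theta> / (real n + 1)) * (real n + 1) powr \<kappa> + C / (real n + 1) \<le> (real n + 2) powr \<kappa>"
    unfolding eventually_sequentially by blast
  \<comment> \<open>\<open>e N \<le> K\<close> starts the induction; \<open>1 \<le> K\<close> lets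
    the surplus of the supersolution, counted once, pay for the inhomogeneous term.\<close>
  define K where "K = 1 + e N"
  have bound: "e n \<le> (real n + 1) powr \<kappa> * K" if "n \<ge> N" for n
    using that
  proof (induction n rule: dec_induct)
    case base
    have "1 * (1 + e N) \<le> (real N + 1) powr \<kappa> * K"
      using nonneg[of N] \<kappa> unfolding K_def by (intro mult_right_mono ge_one_powr_ge_zero) auto
    thus ?case by simp
  next
    case (step n)
    let ?q = "1 + \<theta> / (real n + 1)"
    have "K \<ge> 1" using nonneg[of N] by (simp add: K_def)
    have q: "?q \<ge> 0" using \<theta> by (auto intro!: add_nonneg_nonneg divide_nonneg_nonneg)
    have "e (Suc n) \<le> ?q * e n + C / (real n + 1)" using N(1) step by simp
    also have "\<dots> \<le> ?q * ((real n + 1) powr \<kappa> * K) + C / (real n + 1)"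
      using step q by (intro add_right_mono mult_left_mono) auto
    also have "\<dots> \<le> ?q * ((real n + 1) powr \<kappa> * K) + (((real n + 2) powr \<kappa>) - ?q * (real n + 1) powr \<kappa>)"
      using N(2)[of n] step by linarith
    also have "\<dots> \<le> (real n + 2) powr \<kappa> * K"
    proof -
      have "?q * (real n + 1) powr \<kappa> \<le> (real n + 2) powr \<kappa>"
        using N(2)[of n] step C by (smt (verit) divide_nonneg_nonneg of_nat_0_le_iff)
      hence "?q * (real n + 1) powr \<kappa> * (K - 1) \<le> (real n + 2) powr \<kappa> * (K - 1)"
        using \<open>K \<ge> 1\<close> by (intro mult_right_mono) auto
      thus ?thesis by (simp only: right_diff_distrib mult_1_right mult.assoc)
    qed
    finally show ?case by (simp add: add.commute)
  qed
  have "(\<lambda>n. (real n + 1) powr \<kappa> / real n) \<longlonglongrightarrow> 0"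
    using \<kappa> by real_asymp
  hence "(\<lambda>n. K * ((real n + 1) powr \<kappa> / real n)) \<longlonglongrightarrow> 0"
    by (rule tendsto_mult_right_zero)
  hence "(\<lambda>n. (real n + 1) powr \<kappa> * K / real n) \<longlonglongrightarrow> 0"
    by (simp add: mult.commute)
  thus ?thesis
    by (rule tendsto_sandwich[OF _ _ tendsto_const, rotated 2])
      (use nonneg bound in \<open>auto intro!: eventually_sequentiallyI[of N] divide_right_mono\<close>)
qed

text \<open>The left side is 1 + (2 \<rho> + \<epsilon>) / n up to O(1 / n^2); the strict gap to
  \<theta> absorbs the remainder for large n.\<close>

lemma eventually_square_factor_le:
  fixes \<rho> \<epsilon> \<theta> :: real
  assumes "2 * \<rho> + \<epsilon> < \<theta>"
  shows "eventually (\<lambda>n. (1 + \<rho> / (real n + 1))\<^sup>2 * (1 + \<epsilon> / (real n + 1)) \<le> 1 + \<theta> / (real n + 1)) sequentially"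
proof -
  have "((\<lambda>x::real. (x + 1) * ((1 + \<rho> / (x + 1))\<^sup>2 * (1 + \<epsilon> / (x + 1)) - 1)) \<longlongrightarrow> 2 * \<rho> + \<epsilon>) at_top"
    by real_asymp
  hence "(\<lambda>n. (real n + 1) * ((1 + \<rho> / (real n + 1))\<^sup>2 * (1 + \<epsilon> / (real n + 1)) - 1)) \<longlonglongrightarrow> 2 * \<rho> + \<epsilon>"
    by (rule filterlim_compose[OF _ filterlim_real_sequentially])
  from order_tendstoD(2)[OF this assms] show ?thesis
  proof eventually_elim
    case (elim n)
    hence "(1 + \<rho> / (real n + 1))\<^sup>2 * (1 + \<epsilon> / (real n + 1)) - 1 < \<theta> / (real n + 1)"
      by (simp add: less_divide_eq mult.commute)
    thus ?case by linarith
  qed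
qed

text \<open>Meant mainly for squares: if f has multiplier 1 + \<rho> / (n + 1), then f^2 has the
  squared multiplier, \<epsilon> leaves room for the cross term, and the conclusion reads f = o(sqrt
  n).\<close>

lemma sublinear_of_square_recursion:
  fixes e :: "nat \<Rightarrow> real" and \<rho> \<epsilon> C :: real
  assumes nonneg: "\<And>n. 0 \<le> e n"
    and \<rho>: "2 * \<rho> + \<epsilon> < 1" and C: "0 \<le> C"
    and step: "\<And>n. e (Suc n) \<le> (1 + \<rho> / (real n + 1))\<^sup>2 * (1 + \<epsilon> / (real n + 1)) * e n + C / (real n + 1)"
  shows "(\<lambda>n. e n / real n) \<longlonglongrightarrow> 0"
proof -
  \<comment> \<open>The maximum with 0 covers negative exponents, since the comparison with a power
    asks for a positive \<theta>.\<close>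
  obtain \<theta> where "max 0 (2 * \<rho> + \<epsilon>) < \<theta>" "\<theta> < 1"
    using dense[of "max 0 (2 * \<rho> + \<epsilon>)" 1] \<rho> by auto
  hence \<theta>: "0 < \<theta>" "\<theta> < 1" "2 * \<rho> + \<epsilon> < \<theta>" by auto
  have "eventually (\<lambda>n. e (Suc n) \<le> (1 + \<theta> / (real n + 1)) * e n + C / (real n + 1)) sequentially"
    using eventually_square_factor_le[OF \<theta>(3)]
    by eventually_elim (rule order_trans[OF step add_right_mono[OF mult_right_mono[OF _ nonneg]]])
  with nonneg \<theta>(1,2) C show ?thesis by (rule sublinear_of_recursion)
qed

text \<open>
  Iterating \<open>\<phi> (n + 1) x \<approx> exp (- s x\<^sup>2 / 2) * \<phi> n (x * (1 + \<rho> / (n + 1)))\<close> down to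
  \<open>n = 0\<close> produces the Gaussian exponent \<open>s x\<^sup>2 * variance_seq \<rho> n / 2\<close>; one-step errors of order
  \<open>\<bar>x\<bar> / (n + 1)\<close> accumulate to \<open>\<bar>x\<bar> * drift_error_seq \<rho> n\<close>, and every intermediate argument is
  at most \<open>\<bar>x\<bar> * growth_seq \<rho> n\<close>.
\<close>

primrec variance_seq :: "real \<Rightarrow> nat \<Rightarrow> real" where
  "variance_seq \<rho> 0 = 0"
| "variance_seq \<rho> (Suc n) = variance_seq \<rho> n * (1 + \<rho> / (real n + 1))\<^sup>2 + 1"

primrec drift_error_seq :: "real \<Rightarrow> nat \<Rightarrow> real" where
  "drift_error_seq \<rho> 0 = 1"
| "drift_error_seq \<rho> (Suc n) = drift_error_seq \<rho> n * (1 + \<rho> / (real n + 1)) + 1 / (real n + 1)"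

primrec growth_seq :: "real \<Rightarrow> nat \<Rightarrow> real" where
  "growth_seq \<rho> 0 = 1"
| "growth_seq \<rho> (Suc n) = growth_seq \<rho> n * (1 + max \<rho> 0 / (real n + 1))"

lemma step_factor_nonneg:
  fixes \<rho> :: real
  assumes "-1 < \<rho>"
  shows "0 \<le> 1 + \<rho> / (real n + 1)"
proof -
  have "- 1 \<le> \<rho> / (real n + 1)" using assms by (simp add: le_divide_eq)
  thus ?thesis by linarith
qed

lemma variance_seq_nonneg: "0 \<le> variance_seq \<rho> n"
  by (induction n) auto

lemma drift_error_seq_nonneg: "-1 < \<rho> \<Longrightarrow> 0 \<le> drift_error_seq \<rho> n"
  by (induction n) (auto intro!: add_nonneg_nonneg mult_nonneg_nonneg step_factor_nonneg)

lemma growth_seq_ge_1: "1 \<le> growth_seq \<rho> n"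
proof (induction n)
  case (Suc n)
  have "1 * 1 \<le> growth_seq \<rho> n * (1 + max \<rho> 0 / (real n + 1))"
    using Suc by (intro mult_mono) (auto intro!: divide_nonneg_nonneg)
  thus ?case by simp
qed simp

text \<open>The linear ansatz L (n + 1) satisfies the recursion up to L \<rho>^2 / (n + 1) exactly
  when L = 2 \<rho> L + 1, which fixes L. The deviation from the ansatz then obeys a recursion with
  the same squared multiplier and is o(n).\<close>

lemma variance_seq_lim:
  assumes "\<rho> < 1 / 2"
  shows "(\<lambda>n. variance_seq \<rho> n / real n) \<longlonglongrightarrow> 1 / (1 - 2 * \<rho>)"
proof -
  define L where "L = 1 / (1 - 2 * \<rho>)"
  have L: "2 * \<rho> * L + 1 = L" "L > 0" using assms by (auto simp: L_def field_simps)
  define e where "e n = variance_seq \<rho> n - L * (real n + 1)" for n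
  have e_Suc: "e (Suc n) = (1 + \<rho> / (real n + 1))\<^sup>2 * e n + L * \<rho>\<^sup>2 / (real n + 1)" for n
  proof -
    define q where "q = (1 + \<rho> / (real n + 1))\<^sup>2"
    have "N * (1 + \<rho> / N)\<^sup>2 = N + 2 * \<rho> + \<rho>\<^sup>2 / N" if "N > 0" for N :: real
      using that by (simp add: field_simps power2_eq_square)
    from this[of "real n + 1"]
    have q: "(real n + 1) * q = (real n + 1) + 2 * \<rho> + \<rho>\<^sup>2 / (real n + 1)"
      unfolding q_def by simp
    have "L * ((real n + 1) * q) = L * (real n + 1) + 2 * \<rho> * L + L * \<rho>\<^sup>2 / (real n + 1)"
      unfolding q by (simp add: distrib_left)
    moreover have "q * e n = variance_seq \<rho> n * q - L * ((real n + 1) * q)"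
      unfolding e_def by (simp add: right_diff_distrib)
    moreover have "e (Suc n) = variance_seq \<rho> n * q + 1 - L * (real n + 1) - L"
      unfolding e_def q_def by (simp add: distrib_left)
    ultimately show ?thesis unfolding q_def[symmetric] using L by linarith
  qed
  have "(\<lambda>n. \<bar>e n\<bar> / real n) \<longlonglongrightarrow> 0"
  proof (rule sublinear_of_square_recursion[where \<rho> = \<rho> and \<epsilon> = 0 and C = "L * \<rho>\<^sup>2"])
    show "\<bar>e (Suc n)\<bar> \<le> (1 + \<rho> / (real n + 1))\<^sup>2 * (1 + 0 / (real n + 1)) * \<bar>e n\<bar> + L * \<rho>\<^sup>2 / (real n + 1)" for n
    proof -
      have "\<bar>x * y + z\<bar> \<le> x * (1 + 0 / w) * \<bar>y\<bar> + z" if "0 \<le> x" "0 \<le> z" for w x y z :: real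
        using abs_triangle_ineq[of "x * y" z] that by (simp add: abs_mult)
      thus ?thesis unfolding e_Suc by this (use L(2) in auto)
    qed
  qed (use assms L(2) in auto)
  hence "(\<lambda>n. e n / real n) \<longlonglongrightarrow> 0"
    by (subst tendsto_rabs_zero_iff[symmetric]) (simp add: abs_divide)
  moreover have "(\<lambda>n. (real n + 1) / real n) \<longlonglongrightarrow> 1" by real_asymp
  hence "(\<lambda>n. L * ((real n + 1) / real n)) \<longlonglongrightarrow> L * 1" by (intro tendsto_mult tendsto_const)
  ultimately have "(\<lambda>n. e n / real n + L * ((real n + 1) / real n)) \<longlonglongrightarrow> 0 + L * 1"
    by (rule tendsto_add)
  thus ?thesis by (simp add: e_def L_def diff_divide_distrib)
qed

text \<open>In the squared recursion the cross term is split by 2 z \<le> \<epsilon> z^2 + 1 /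
  \<epsilon>. The first part slightly enlarges the multiplier, which stays admissible because
  \<epsilon> is half of the gap 1 - 2 \<rho>.\<close>

lemma drift_error_seq_lim:
  assumes "-1 < \<rho>" "\<rho> < 1 / 2"
  shows "(\<lambda>n. drift_error_seq \<rho> n / sqrt (real n)) \<longlonglongrightarrow> 0"
proof -
  define \<epsilon> where "\<epsilon> = (1 - 2 * \<rho>) / 2"
  have \<epsilon>: "0 < \<epsilon>" "2 * \<rho> + \<epsilon> < 1" using assms by (auto simp: \<epsilon>_def field_simps)
  let ?R = "drift_error_seq \<rho>"
  have "(\<lambda>n. (?R n)\<^sup>2 / real n) \<longlonglongrightarrow> 0"
  proof (rule sublinear_of_square_recursion[where \<rho> = \<rho> and \<epsilon> = \<epsilon> and C = "1 / \<epsilon> + 1"])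
    fix n
    define z where "z = ?R n * (1 + \<rho> / (real n + 1))"
    define N where "N = real n + 1"
    have N: "N \<ge> 1" by (simp add: N_def)
    have "0 \<le> (\<epsilon> * z - 1)\<^sup>2 / \<epsilon>" using \<epsilon> by simp
    also have "\<dots> = \<epsilon> * z\<^sup>2 - 2 * z + 1 / \<epsilon>" using \<epsilon> by (simp add: field_simps power2_eq_square)
    finally have *: "2 * z \<le> \<epsilon> * z\<^sup>2 + 1 / \<epsilon>" by simp
    have "(?R (Suc n))\<^sup>2 = (z + 1 / N)\<^sup>2" by (simp add: z_def N_def)
    also have "\<dots> = z\<^sup>2 + 2 * z / N + 1 / N * (1 / N)" by (simp add: power2_eq_square algebra_simps)
    also have "\<dots> \<le> z\<^sup>2 + (\<epsilon> * z\<^sup>2 + 1 / \<epsilon>) / N + 1 / N * 1"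
      using * N by (intro add_mono divide_right_mono mult_left_mono) auto
    also have "\<dots> = z\<^sup>2 * (1 + \<epsilon> / N) + (1 / \<epsilon> + 1) / N"
      by (simp add: distrib_left add_divide_distrib)
    also have "z\<^sup>2 * (1 + \<epsilon> / N) = (1 + \<rho> / (real n + 1))\<^sup>2 * (1 + \<epsilon> / (real n + 1)) * (?R n)\<^sup>2"
      by (simp add: z_def N_def power_mult_distrib)
    finally show "(?R (Suc n))\<^sup>2 \<le> (1 + \<rho> / (real n + 1))\<^sup>2 * (1 + \<epsilon> / (real n + 1)) * (?R n)\<^sup>2 + (1 / \<epsilon> + 1) / (real n + 1)"
      by (simp add: N_def)
  qed (use \<epsilon> in auto)
  from tendsto_real_sqrt[OF this] show ?thesis
    using drift_error_seq_nonneg[OF assms(1)] by (simp add: real_sqrt_divide)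
qed

lemma growth_seq_lim:
  assumes "\<rho> < 1 / 2"
  shows "(\<lambda>n. growth_seq \<rho> n / sqrt (real n)) \<longlonglongrightarrow> 0"
proof -
  have "(\<lambda>n. (growth_seq \<rho> n)\<^sup>2 / real n) \<longlonglongrightarrow> 0"
    by (rule sublinear_of_square_recursion[where \<rho> = "max \<rho> 0" and \<epsilon> = 0 and C = 0])
      (use assms in \<open>auto simp: power_mult_distrib\<close>)
  from tendsto_real_sqrt[OF this] show ?thesis
    using order_trans[OF zero_le_one growth_seq_ge_1] by (simp add: real_sqrt_divide)
qed

section \<open>Estimates for complex exponentials\<close>

lemma char_normal_density:
  assumes "0 < \<sigma>"
  shows "char (density lborel (normal_density 0 \<sigma>)) t = exp (- (\<sigma> * t)\<^sup>2 / 2)"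
proof -
  interpret prob_space std_normal_distribution
    by (rule prob_space_normal_density) simp
  have "distributed std_normal_distribution lborel (\<lambda>x. x) std_normal_density"
    by (auto simp: distributed_def distr_id2)
  from normal_density_affine[OF this, of \<sigma> 0] assms
  have "density lborel (normal_density 0 \<sigma>) = distr std_normal_distribution borel (\<lambda>x. \<sigma> * x)"
    by (simp add: distributed_def cong: distr_cong)
  hence "char (density lborel (normal_density 0 \<sigma>)) t = char std_normal_distribution (\<sigma> * t)"
    unfolding char_def by (simp add: integral_distr mult_ac)
  thus ?thesis
    by (simp add: char_std_normal_distribution)
qed

lemma iexp_diff_le: "cmod (iexp x - iexp y) \<le> \<bar>x - y\<bar>"
proof -
  have "iexp x - iexp y = iexp y * (iexp (x - y) - 1)"
    by (simp add: right_diff_distrib flip: exp_add)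
  hence "cmod (iexp x - iexp y) = cmod (iexp (x - y) - 1)" by (simp add: norm_mult)
  thus ?thesis using iexp_approx1[of "x - y" 0] by simp
qed

lemma iexp_second_order: "cmod (iexp x - (1 + \<i> * x - x\<^sup>2 / 2)) \<le> \<bar>x\<bar> ^ 3 / 6"
proof -
  have "(\<Sum>k\<le>2. (\<i> * complex_of_real x) ^ k / fact k) = 1 + \<i> * x - x\<^sup>2 / 2"
    by (simp add: numeral_2_eq_2 power_mult_distrib)
  moreover have "\<bar>x\<bar> ^ Suc 2 / fact (Suc 2) = \<bar>x\<bar> ^ 3 / 6"
    by (simp add: fact_numeral numeral_3_eq_3)
  ultimately show ?thesis using iexp_approx1[of x 2] by metis
qed

lemma abs_exp_minus_linear_le:
  fixes u :: real
  assumes "0 \<le> u"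
  shows "\<bar>exp (- u) - (1 - u)\<bar> \<le> u\<^sup>2"
proof -
  have "exp (- u) \<le> 1 / (1 + u)"
    using exp_ge_add_one_self[of u] assms by (simp add: exp_minus inverse_eq_divide frac_le)
  also have "\<dots> \<le> 1 - u + u\<^sup>2"
  proof -
    have "(1 - u + u\<^sup>2) * (1 + u) = 1 + u ^ 3"
      by (simp add: algebra_simps power2_eq_square power3_eq_cube)
    thus ?thesis using assms by (simp add: pos_divide_le_eq)
  qed
  finally show ?thesis using exp_ge_add_one_self[of "- u"] by (simp add: abs_le_iff)
qed

text \<open>Serves to compare the one-step factor of the urn with that of the limiting recursion
  through a common first-order expansion: y is the exponent with the random rate, z the one with the
  deterministic rate. The term z^2 will be harmless because z carries a factor 1 / (n + 1).\<close>

lemma iexp_times_exp_approx: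
  fixes u y z :: real
  assumes u: "0 \<le> u"
  shows "cmod (iexp z * exp (- u) - (1 + \<i> * y - u)) \<le> z\<^sup>2 + 2 * u\<^sup>2 + \<bar>z - y\<bar>"
proof -
  define e where "e = exp (- u)"
  have e: "0 \<le> e" "e \<le> 1" "\<bar>e - 1\<bar> \<le> u" "\<bar>e - (1 - u)\<bar> \<le> u\<^sup>2"
    using u exp_ge_add_one_self[of "- u"] abs_exp_minus_linear_le[OF u] by (auto simp: e_def abs_le_iff)
  have "iexp z * e - (1 + \<i> * y - u) =
      (iexp z - (1 + \<i> * z)) * e + complex_of_real (e - (1 - u)) + \<i> * (z * (e - 1)) + \<i> * (z - y)"
    by (simp add: algebra_simps)
  also have "cmod \<dots> \<le> cmod ((iexp z - (1 + \<i> * z)) * e) + cmod (complex_of_real (e - (1 - u)))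
      + cmod (\<i> * (z * (e - 1))) + cmod (\<i> * (z - y))"
    by (intro norm_triangle_mono order_refl norm_triangle_ineq)
  also have "cmod ((iexp z - (1 + \<i> * z)) * e) = cmod (iexp z - (1 + \<i> * z)) * e"
    using e by (simp add: norm_mult)
  also have "\<dots> \<le> z\<^sup>2 / 2 * 1"
    using iexp_approx1[of z 1] e by (intro mult_mono) (auto simp: numeral_2_eq_2 power2_eq_square)
  also have "cmod (complex_of_real (e - (1 - u))) \<le> u\<^sup>2"
    unfolding norm_of_real by (rule e)
  also have "cmod (\<i> * (z * (e - 1))) = \<bar>z\<bar> * \<bar>e - 1\<bar>"
    unfolding norm_mult norm_of_real by (simp add: abs_mult)
  also have "\<dots> \<le> \<bar>z\<bar> * u" using e by (intro mult_left_mono) auto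
  also have "\<dots> \<le> z\<^sup>2 / 2 + u\<^sup>2 / 2"
    using zero_le_power2[of "\<bar>z\<bar> - u"] by (simp add: power2_diff)
  also have "cmod (\<i> * (z - y)) = \<bar>z - y\<bar>"
    unfolding norm_mult norm_of_real by simp
  finally have "cmod (iexp z * e - (1 + \<i> * y - u)) \<le> z\<^sup>2 / 2 * 1 + u\<^sup>2 + (z\<^sup>2 / 2 + u\<^sup>2 / 2) + \<bar>z - y\<bar>"
    by simp
  moreover have "0 \<le> u\<^sup>2" by simp
  ultimately show ?thesis unfolding e_def by linarith
qed

section \<open>The urn as a Markov chain\<close>

definition imbalance :: "nat \<times> nat \<Rightarrow> real" where
  "imbalance y = real (fst y) - real (snd y)"

definition ball_count :: "nat \<times> nat \<Rightarrow> real" where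
  "ball_count y = real (fst y) + real (snd y)"

lemma abs_imbalance_le_total: "\<bar>imbalance y\<bar> \<le> ball_count y"
  by (simp add: imbalance_def ball_count_def)

locale positive_polya_friedman_urn = polya_friedman_urn +
  assumes total_pos: "0 < y1 + y2" and abc_pos: "0 < a" "0 < b" "0 < c"
    and p_pos: "0 < p" and p_less_1: "p < 1"
begin

section \<open>Filtration, state and measurability\<close>

lemma space_history [simp]: "space (urn_history M \<xi> \<eta> n) = space M"
  by (simp add: urn_history_def space_measure_of_conv)

lemma sets_history:
  "sets (urn_history M \<xi> \<eta> n) = sigma_sets (space M)
     ({\<xi> k -` A \<inter> space M | k A. k \<in> {1..n}} \<union> {\<eta> k -` A \<inter> space M | k A. k \<in> {1..n}})"
  unfolding urn_history_def by (subst sets_measure_of) auto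

lemma history_mono: "m \<le> n \<Longrightarrow> sets (urn_history M \<xi> \<eta> m) \<subseteq> sets (urn_history M \<xi> \<eta> n)"
proof -
  assume "m \<le> n"
  hence "{1..m} \<subseteq> {1..n}" by simp
  thus ?thesis unfolding sets_history by (intro sigma_sets_mono') blast
qed

lemma xi_measurable [measurable]: "\<xi> (Suc n) \<in> measurable M (count_space UNIV)"
  using xi_indep by (auto simp: indep_vars_def2)

lemma subalgebra_history: "subalgebra M (urn_history M \<xi> \<eta> n)"
proof -
  have "\<xi> k -` A \<inter> space M \<in> sets M" "\<eta> k -` A \<inter> space M \<in> sets M" if "k \<in> {1..n}" for k A
    using that by (cases k; simp add: measurable_sets[OF xi_measurable] measurable_sets[OF eta_measurable])+
  thus ?thesis
    unfolding subalgebra_def sets_history by (auto intro!: sets.sigma_sets_subset)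
qed

lemma sigma_finite_subalgebra_history: "sigma_finite_subalgebra M (urn_history M \<xi> \<eta> n)"
  by (intro finite_measure_subalgebra_is_sigma_finite finite_measure_subalgebra.intro
      finite_measure_subalgebra_axioms.intro subalgebra_history finite_measure_axioms)

definition colours :: "nat \<Rightarrow> 'a \<Rightarrow> nat \<times> nat" where
  "colours n \<omega> = (Y1 n \<omega>, Y2 n \<omega>)"

text \<open>The law of \<open>\<xi>\<close> allows further values on a null set. The default (0, 0)
  agrees with the urn equations there, so the recursion for \<open>colours\<close> holds at every
  point and not only almost everywhere.\<close>

definition increment :: "nat \<Rightarrow> nat \<Rightarrow> nat \<times> nat" where
  "increment i j = (if i = 1 then if j = 1 then (a, b) else (b, a)
     else if i = 0 then if j = 1 then (c, 0) else (0, c) else (0, 0))"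

lemma colours_0: "\<omega> \<in> space M \<Longrightarrow> colours 0 \<omega> = (y1, y2)"
  by (simp add: colours_def Y1_0 Y2_0)

lemma colours_Suc:
  assumes "\<omega> \<in> space M"
  shows "colours (Suc n) \<omega> = (fst (colours n \<omega>) + fst (increment (\<xi> (Suc n) \<omega>) (\<eta> (Suc n) \<omega>)),
    snd (colours n \<omega>) + snd (increment (\<xi> (Suc n) \<omega>) (\<eta> (Suc n) \<omega>)))"
  \<comment> \<open>No equation for \<open>Y2\<close> is given; it is recovered from the total and
    \<open>Y1\<close>.\<close>
  using Y1_Suc[OF assms, of n] T_Suc[OF assms, of n] eta_range[OF assms, of n]
  by (auto simp: colours_def increment_def urn_total_def)

lemma colours_bounded:
  "\<omega> \<in> space M \<Longrightarrow> fst (colours n \<omega>) + snd (colours n \<omega>) \<le> y1 + y2 + n * (a + b + c)"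
  by (induction n) (auto simp: colours_0 colours_Suc increment_def)

text \<open>Measurability with respect to the history, and not merely to \<open>M\<close>, is what
  lets functions of the state be pulled out of conditional expectations.\<close>

lemma colours_measurable_history:
  "colours n \<in> measurable (urn_history M \<xi> \<eta> n) (count_space UNIV)"
proof (induction n)
  case 0
  have "(\<lambda>_. (y1, y2)) \<in> measurable (urn_history M \<xi> \<eta> 0) (count_space UNIV)" by simp
  thus ?case by (rule measurable_cong[THEN iffD1, rotated]) (simp add: colours_0)
next
  case (Suc n)
  let ?F = "urn_history M \<xi> \<eta> (Suc n)"
  have [measurable]: "colours n \<in> measurable ?F (count_space UNIV)"
    using Suc history_mono[of n "Suc n"] by (auto simp: measurable_def)
  have [measurable]: "\<xi> (Suc n) \<in> measurable ?F (count_space UNIV)" "\<eta> (Suc n) \<in> measurable ?F (count_space UNIV)"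
  proof -
    have "Suc n \<in> {1..Suc n}" by simp
    hence "\<xi> (Suc n) -` A \<inter> space M \<in> sets ?F" "\<eta> (Suc n) -` A \<inter> space M \<in> sets ?F" for A
      unfolding sets_history by (blast intro: sigma_sets.Basic)+
    thus "\<xi> (Suc n) \<in> measurable ?F (count_space UNIV)" "\<eta> (Suc n) \<in> measurable ?F (count_space UNIV)"
      by (auto intro!: measurableI)
  qed
  have "(\<lambda>\<omega>. (fst (colours n \<omega>) + fst (increment (\<xi> (Suc n) \<omega>) (\<eta> (Suc n) \<omega>)),
    snd (colours n \<omega>) + snd (increment (\<xi> (Suc n) \<omega>) (\<eta> (Suc n) \<omega>)))) \<in> measurable ?F (count_space UNIV)"
    by measurable
  thus ?case by (rule measurable_cong[THEN iffD1, rotated]) (simp add: colours_Suc)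
qed

lemma colours_measurable [measurable]: "colours n \<in> measurable M (count_space UNIV)"
  by (rule measurable_from_subalg[OF subalgebra_history colours_measurable_history])

text \<open>Only finitely many states are reachable by time n, so every function of the state is
  bounded. This settles all integrability questions below.\<close>

lemma integrable_colours:
  fixes f :: "nat \<times> nat \<Rightarrow> 'b :: {banach, second_countable_topology}"
  shows "integrable M (\<lambda>\<omega>. f (colours n \<omega>))"
proof -
  let ?N = "y1 + y2 + n * (a + b + c)"
  have "colours n ` space M \<subseteq> {..?N} \<times> {..?N}"
    using add_leD1[OF colours_bounded[of _ n]] add_leD2[OF colours_bounded[of _ n]]
    by (intro image_subsetI) (simp add: mem_Times_iff)
  hence "finite (colours n ` space M)"
    by (rule finite_subset) auto
  hence "finite (norm ` f ` colours n ` space M)"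
    by simp
  then obtain B where "\<And>\<omega>. \<omega> \<in> space M \<Longrightarrow> norm (f (colours n \<omega>)) \<le> B"
    by (metis (no_types, lifting) Max_ge image_eqI)
  thus ?thesis
    by (intro integrable_const_bound[where B = B]) auto
qed

lemma AE_xi: "AE \<omega> in M. \<xi> (Suc n) \<omega> = 0 \<or> \<xi> (Suc n) \<omega> = 1"
proof -
  have "prob ({\<omega> \<in> space M. \<xi> (Suc n) \<omega> = 0} \<union> {\<omega> \<in> space M. \<xi> (Suc n) \<omega> = 1}) = 1"
    by (subst finite_measure_Union) (auto simp: xi_0 xi_1 simp del: One_nat_def)
  hence "prob {\<omega> \<in> space M. \<xi> (Suc n) \<omega> = 0 \<or> \<xi> (Suc n) \<omega> = 1} = 1"
    by (simp add: Un_def conj_disj_distribL[symmetric] set_eq_iff conj_commute Collect_disj_eq[symmetric])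
  thus ?thesis by (rule AE_prob_1[THEN eventually_mono]) auto
qed

lemma cond_prob_xi:
  "AE \<omega> in M. cond_prob_alg M (urn_history M \<xi> \<eta> n) (\<xi> (Suc n) -` {i} \<inter> space M) \<omega>
     = prob (\<xi> (Suc n) -` {i} \<inter> space M)"
proof -
  interpret F: sigma_finite_subalgebra M "urn_history M \<xi> \<eta> n"
    by (rule sigma_finite_subalgebra_history)
  let ?E = "\<xi> (Suc n) -` {i} \<inter> space M"
  have [measurable]: "?E \<in> sets M" by (rule measurable_sets[OF xi_measurable]) simp
  show ?thesis unfolding cond_prob_alg_def
  proof (rule F.real_cond_exp_charact)
    fix B assume B: "B \<in> sets (urn_history M \<xi> \<eta> n)"
    hence [measurable]: "B \<in> sets M" using subalgebra_history[of n] by (auto simp: subalgebra_def)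
    have "prob (?E \<inter> B) = prob ?E * prob B"
      using B by (intro indep_setD[OF xi_indep_history]) auto
    moreover have "space M \<inter> (B \<inter> ?E) = ?E \<inter> B" by auto
    hence "(\<integral>x\<in>B. indicat_real ?E x \<partial>M) = prob (?E \<inter> B)"
      by (simp add: set_lebesgue_integral_def indicator_inter_arith[symmetric] Int_commute)
    moreover have "(\<integral>x\<in>B. prob ?E \<partial>M) = prob ?E * prob B"
      by (simp add: set_lebesgue_integral_def)
    ultimately show "(\<integral>x\<in>B. indicat_real ?E x \<partial>M) = (\<integral>x\<in>B. prob ?E \<partial>M)" by simp
  qed (auto intro!: integrable_real_indicator simp: emeasure_eq_measure)
qed

section \<open>One-step transition of the chain\<close>

definition share :: "nat \<times> nat \<Rightarrow> real" where
  "share y = real (fst y) / real (fst y + snd y)"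

text \<open>A function of the state is history-measurable, so the indicator may be replaced by its
  conditional probability, and conditional independence factors the latter. These two kinds of event
  suffice: drawing type 2 is their difference.\<close>

lemma expectation_xi_event:
  fixes g :: "nat \<times> nat \<Rightarrow> real" and n :: nat
  defines "E i \<equiv> \<xi> (Suc n) -` {i} \<inter> space M"
  shows "(\<integral>\<omega>. g (colours n \<omega>) * indicat_real (E i) \<omega> \<partial>M) = prob (E i) * (\<integral>\<omega>. g (colours n \<omega>) \<partial>M)"
    and "(\<integral>\<omega>. g (colours n \<omega>) * indicat_real (E i \<inter> (\<eta> (Suc n) -` {1} \<inter> space M)) \<omega> \<partial>M)
      = prob (E i) * (\<integral>\<omega>. g (colours n \<omega>) * share (colours n \<omega>) \<partial>M)"
proof -
  interpret F: sigma_finite_subalgebra M "urn_history M \<xi> \<eta> n"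
    by (rule sigma_finite_subalgebra_history)
  let ?F = "urn_history M \<xi> \<eta> n" and ?H = "\<eta> (Suc n) -` {1} \<inter> space M"
  have [measurable]: "E i \<in> sets M" "?H \<in> sets M"
    unfolding E_def by (rule measurable_sets[OF xi_measurable] measurable_sets[OF eta_measurable], simp)+
  have meas: "(\<lambda>\<omega>. g (colours n \<omega>)) \<in> borel_measurable ?F"
    by (rule measurable_compose[OF colours_measurable_history]) simp
  have int: "integrable M (\<lambda>\<omega>. g (colours n \<omega>) * indicat_real A \<omega>)" if "A \<in> sets M" for A
    by (rule integrable_real_mult_indicator[OF that integrable_colours])
  have E: "AE \<omega> in M. real_cond_exp M ?F (indicat_real (E i)) \<omega> = prob (E i)"
    using cond_prob_xi[of n i] unfolding E_def cond_prob_alg_def .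
  have "(\<integral>\<omega>. g (colours n \<omega>) * indicat_real (E i) \<omega> \<partial>M) =
      (\<integral>\<omega>. g (colours n \<omega>) * real_cond_exp M ?F (indicat_real (E i)) \<omega> \<partial>M)"
    by (rule F.real_cond_exp_intg(2)[symmetric, OF int meas]) (auto simp del: One_nat_def)
  also have "\<dots> = (\<integral>\<omega>. g (colours n \<omega>) * prob (E i) \<partial>M)"
    by (rule integral_cong_AE) (use E in \<open>auto simp del: One_nat_def\<close>)
  finally show "(\<integral>\<omega>. g (colours n \<omega>) * indicat_real (E i) \<omega> \<partial>M) = prob (E i) * (\<integral>\<omega>. g (colours n \<omega>) \<partial>M)"
    by simp
  have H: "AE \<omega> in M. real_cond_exp M ?F (indicat_real ?H) \<omega> = share (colours n \<omega>)"
  proof -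
    have "?H = {\<omega> \<in> space M. \<eta> (Suc n) \<omega> = 1}" by auto
    thus ?thesis using eta_cond_prob[of n]
      by (simp add: cond_prob_alg_def urn_proportion_def urn_total_def share_def colours_def)
  qed
  have "AE \<omega> in M. real_cond_exp M ?F (indicat_real (E i \<inter> ?H)) \<omega> =
      real_cond_exp M ?F (indicat_real (E i)) \<omega> * real_cond_exp M ?F (indicat_real ?H) \<omega>"
    using xi_eta_cond_indep[of n] unfolding cond_indep_var_def cond_prob_alg_def E_def by simp
  with E H have EH: "AE \<omega> in M. real_cond_exp M ?F (indicat_real (E i \<inter> ?H)) \<omega> = prob (E i) * share (colours n \<omega>)"
    by eventually_elim simp
  have "(\<integral>\<omega>. g (colours n \<omega>) * indicat_real (E i \<inter> ?H) \<omega> \<partial>M) =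
      (\<integral>\<omega>. g (colours n \<omega>) * real_cond_exp M ?F (indicat_real (E i \<inter> ?H)) \<omega> \<partial>M)"
    by (rule F.real_cond_exp_intg(2)[symmetric, OF int meas]) (auto simp del: One_nat_def)
  also have "\<dots> = (\<integral>\<omega>. prob (E i) * (g (colours n \<omega>) * share (colours n \<omega>)) \<partial>M)"
    by (rule integral_cong_AE) (use EH in \<open>auto simp del: One_nat_def\<close>)
  finally show "(\<integral>\<omega>. g (colours n \<omega>) * indicat_real (E i \<inter> ?H) \<omega> \<partial>M)
      = prob (E i) * (\<integral>\<omega>. g (colours n \<omega>) * share (colours n \<omega>) \<partial>M)"
    by simp
qed

text \<open>The transition operator of the chain. A real vector space as codomain lets it act both
  on squares and on complex exponentials.\<close>

definition next_mean :: "(nat \<times> nat \<Rightarrow> 'c :: real_vector) \<Rightarrow> nat \<times> nat \<Rightarrow> 'c" where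
  "next_mean f y =
     p *\<^sub>R (share y *\<^sub>R f (fst y + a, snd y + b) + (1 - share y) *\<^sub>R f (fst y + b, snd y + a)) +
     (1 - p) *\<^sub>R (share y *\<^sub>R f (fst y + c, snd y) + (1 - share y) *\<^sub>R f (fst y, snd y + c))"

lemma expectation_colours_Suc_real:
  fixes f :: "nat \<times> nat \<Rightarrow> real"
  shows "(\<integral>\<omega>. f (colours (Suc n) \<omega>) \<partial>M) = (\<integral>\<omega>. next_mean f (colours n \<omega>) \<partial>M)"
proof -
  define E where "E i = \<xi> (Suc n) -` {i} \<inter> space M" for i
  define H where "H = \<eta> (Suc n) -` {1} \<inter> space M"
  have [measurable]: "E i \<in> sets M" "H \<in> sets M" for i
    unfolding E_def H_def by (rule measurable_sets[OF xi_measurable] measurable_sets[OF eta_measurable], simp)+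
  define h where "h i j y = f (fst y + fst (increment i j), snd y + snd (increment i j))" for i j y
  let ?c = "colours n"
  \<comment> \<open>This replaces the case distinction on the draw by indicators of
    \<open>E i\<close> and \<open>E i \<inter> H\<close>: the value for type 2 is used on all of
    \<open>E i\<close> and corrected on \<open>H\<close>.\<close>
  define I where "I i \<omega> = (h i 1 (?c \<omega>) - h i 0 (?c \<omega>)) * indicat_real (E i \<inter> H) \<omega>
    + h i 0 (?c \<omega>) * indicat_real (E i) \<omega>" for i \<omega>
  have int: "integrable M (\<lambda>\<omega>. g (colours n \<omega>) * indicat_real A \<omega>)" if "A \<in> sets M" for A and g :: "nat \<times> nat \<Rightarrow> real"
    by (rule integrable_real_mult_indicator[OF that integrable_colours])
  have intI: "integrable M (I i)" for i
    unfolding I_def by (intro Bochner_Integration.integrable_add int) auto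
  have EI: "(\<integral>\<omega>. I i \<omega> \<partial>M) = prob (E i) * (\<integral>\<omega>. share (?c \<omega>) * h i 1 (?c \<omega>) + (1 - share (?c \<omega>)) * h i 0 (?c \<omega>) \<partial>M)" for i
  proof -
    have "(\<integral>\<omega>. I i \<omega> \<partial>M) = (\<integral>\<omega>. (h i 1 (?c \<omega>) - h i 0 (?c \<omega>)) * indicat_real (E i \<inter> H) \<omega> \<partial>M)
        + (\<integral>\<omega>. h i 0 (?c \<omega>) * indicat_real (E i) \<omega> \<partial>M)"
      unfolding I_def by (intro Bochner_Integration.integral_add int) auto
    also have "\<dots> = prob (E i) * (\<integral>\<omega>. (h i 1 (?c \<omega>) - h i 0 (?c \<omega>)) * share (?c \<omega>) \<partial>M)
        + prob (E i) * (\<integral>\<omega>. h i 0 (?c \<omega>) \<partial>M)"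
      unfolding E_def H_def
      using expectation_xi_event(2)[of "\<lambda>y. h i 1 y - h i 0 y" n i] expectation_xi_event(1)[of "h i 0" n i]
      by simp
    also have "\<dots> = prob (E i) * ((\<integral>\<omega>. (h i 1 (?c \<omega>) - h i 0 (?c \<omega>)) * share (?c \<omega>) \<partial>M)
        + (\<integral>\<omega>. h i 0 (?c \<omega>) \<partial>M))" by (simp add: distrib_left)
    also have "\<dots> = prob (E i) * (\<integral>\<omega>. (h i 1 (?c \<omega>) - h i 0 (?c \<omega>)) * share (?c \<omega>) + h i 0 (?c \<omega>) \<partial>M)"
      by (subst Bochner_Integration.integral_add)
        (auto intro: integrable_colours integrable_colours[where f = "\<lambda>y. (h i 1 y - h i 0 y) * share y"])
    also have "(\<lambda>\<omega>. (h i 1 (?c \<omega>) - h i 0 (?c \<omega>)) * share (?c \<omega>) + h i 0 (?c \<omega>)) =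
        (\<lambda>\<omega>. share (?c \<omega>) * h i 1 (?c \<omega>) + (1 - share (?c \<omega>)) * h i 0 (?c \<omega>))"
      by (auto simp: algebra_simps)
    finally show ?thesis .
  qed
  have probE: "prob (E 1) = p" "prob (E 0) = 1 - p"
  proof -
    have "E i = {\<omega> \<in> space M. \<xi> (Suc n) \<omega> = i}" for i by (auto simp: E_def)
    thus "prob (E 1) = p" "prob (E 0) = 1 - p" using xi_1[of n] xi_0[of n] by simp_all
  qed
  have "(\<integral>\<omega>. f (colours (Suc n) \<omega>) \<partial>M) = (\<integral>\<omega>. I 1 \<omega> + I 0 \<omega> \<partial>M)"
  proof (rule integral_cong_AE)
    show "AE \<omega> in M. f (colours (Suc n) \<omega>) = I 1 \<omega> + I 0 \<omega>"
      using AE_xi[of n] AE_space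
    proof eventually_elim
      case (elim \<omega>)
      have "\<eta> (Suc n) \<omega> = 0 \<or> \<eta> (Suc n) \<omega> = 1" using eta_range[of \<omega> n] elim by auto
      with elim show ?case
        by (auto simp: colours_Suc I_def h_def E_def H_def)
    qed
  qed (use intI in \<open>auto simp: integrable_colours\<close>)
  also have "\<dots> = (\<integral>\<omega>. I 1 \<omega> \<partial>M) + (\<integral>\<omega>. I 0 \<omega> \<partial>M)"
    by (intro Bochner_Integration.integral_add intI)
  also have "\<dots> = (\<integral>\<omega>. p * (share (?c \<omega>) * h 1 1 (?c \<omega>) + (1 - share (?c \<omega>)) * h 1 0 (?c \<omega>)) +
      (1 - p) * (share (?c \<omega>) * h 0 1 (?c \<omega>) + (1 - share (?c \<omega>)) * h 0 0 (?c \<omega>)) \<partial>M)"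
    unfolding EI probE integral_mult_right_zero[symmetric]
    by (rule Bochner_Integration.integral_add[symmetric])
      (rule integrable_colours[where f = "\<lambda>y. p * (share y * h 1 1 y + (1 - share y) * h 1 0 y)"]
        integrable_colours[where f = "\<lambda>y. (1 - p) * (share y * h 0 1 y + (1 - share y) * h 0 0 y)"])+
  finally show ?thesis
    by (simp add: next_mean_def h_def increment_def)
qed

lemma expectation_colours_Suc_complex:
  fixes f :: "nat \<times> nat \<Rightarrow> complex"
  shows "(\<integral>\<omega>. f (colours (Suc n) \<omega>) \<partial>M) = (\<integral>\<omega>. next_mean f (colours n \<omega>) \<partial>M)"
proof (rule complex_eqI)
  note [simp] = integrable_colours
  have "Re (\<integral>\<omega>. f (colours (Suc n) \<omega>) \<partial>M) = (\<integral>\<omega>. Re (f (colours (Suc n) \<omega>)) \<partial>M)"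
    by (subst integral_Re) auto
  also have "\<dots> = (\<integral>\<omega>. next_mean (\<lambda>y. Re (f y)) (colours n \<omega>) \<partial>M)"
    by (rule expectation_colours_Suc_real)
  also have "\<dots> = Re (\<integral>\<omega>. next_mean f (colours n \<omega>) \<partial>M)"
    by (subst integral_Re[symmetric]) (rule integrable_colours, simp add: next_mean_def)
  finally show "Re (\<integral>\<omega>. f (colours (Suc n) \<omega>) \<partial>M) = Re (\<integral>\<omega>. next_mean f (colours n \<omega>) \<partial>M)" .
  have "Im (\<integral>\<omega>. f (colours (Suc n) \<omega>) \<partial>M) = (\<integral>\<omega>. Im (f (colours (Suc n) \<omega>)) \<partial>M)"
    by (subst integral_Im) auto
  also have "\<dots> = (\<integral>\<omega>. next_mean (\<lambda>y. Im (f y)) (colours n \<omega>) \<partial>M)"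
    by (rule expectation_colours_Suc_real)
  also have "\<dots> = Im (\<integral>\<omega>. next_mean f (colours n \<omega>) \<partial>M)"
    by (subst integral_Im[symmetric]) (rule integrable_colours, simp add: next_mean_def)
  finally show "Im (\<integral>\<omega>. f (colours (Suc n) \<omega>) \<partial>M) = Im (\<integral>\<omega>. next_mean f (colours n \<omega>) \<partial>M)" .
qed

section \<open>Second moments\<close>

lemma share_bounds: "0 \<le> share y" "share y \<le> 1"
  by (auto simp: share_def divide_le_eq)

lemma share_eq_imbalance: "0 < ball_count y \<Longrightarrow> 2 * share y - 1 = imbalance y / ball_count y"
  by (simp add: share_def imbalance_def ball_count_def field_simps)

text \<open>The m of the overview: the mean number of balls added in one step.\<close>

definition growth :: real where
  "growth = (real a + real b) * p + real c * (1 - p)"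

text \<open>The rho of the overview. In state y the imbalance changes in mean by
  \<open>drift * growth * (2 * share y - 1)\<close>.\<close>

definition drift :: real where
  "drift = (p * (real a - real b) + (1 - p) * real c) / growth"

text \<open>The s of the overview: the second moment of one increment of the imbalance, the same in
  every state.\<close>

definition step_var :: real where
  "step_var = p * (real a - real b)\<^sup>2 + (1 - p) * (real c)\<^sup>2"

lemma growth_pos: "0 < growth"
  unfolding growth_def using abc_pos p_pos p_less_1 by (intro add_pos_pos mult_pos_pos) auto

lemma drift_growth: "drift * growth = p * (real a - real b) + (1 - p) * real c"
  using growth_pos by (simp add: drift_def)

text \<open>\<open>growth + drift * growth\<close> equals 2pa + 2(1 - p)c and
  \<open>growth - drift * growth\<close> equals 2pb. The lower bound keeps the factors 1 + drift /
  (n + 1) nonnegative; together they allow |drift| to be bounded by 1 in error terms.\<close>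

lemma drift_bounds: "- 1 < drift" "drift < 1"
proof -
  have "0 < p * real a" "0 < p * real b" "0 < (1 - p) * real c"
    using abc_pos p_pos p_less_1 by auto
  hence "- growth < drift * growth" "drift * growth < growth"
    unfolding drift_growth unfolding growth_def by (auto simp: algebra_simps)
  thus "- 1 < drift" "drift < 1"
    using mult_less_cancel_right_pos[OF growth_pos, of "- 1" drift]
      mult_less_cancel_right_pos[OF growth_pos, of drift 1] by simp_all
qed

lemma step_var_pos: "0 < step_var"
  unfolding step_var_def using abc_pos p_pos p_less_1
  by (intro add_nonneg_pos mult_pos_pos mult_nonneg_nonneg) auto

lemma total_colours_pos: "\<omega> \<in> space M \<Longrightarrow> 0 < ball_count (colours n \<omega>)"
proof (induction n)
  case (Suc n) thus ?case by (simp add: colours_Suc ball_count_def)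
next
  case 0
  have "0 < real (y1 + y2)" using total_pos by (simp only: of_nat_0_less_iff)
  with 0 show ?case by (simp add: colours_0 ball_count_def)
qed

text \<open>The urn starts with at least one ball and almost surely gains at least one per step.
  This makes n + 1 a convenient time scale: it is both the centring of the total and a lower bound
  for denominators.\<close>

lemma AE_total_colours_ge: "AE \<omega> in M. real n + 1 \<le> ball_count (colours n \<omega>)"
proof (induction n)
  case 0
  have "AE \<omega> in M. \<omega> \<in> space M" by simp
  thus ?case by eventually_elim (use total_pos in \<open>auto simp: colours_0 ball_count_def\<close>)
next
  case (Suc n)
  from Suc AE_xi[of n] AE_space show ?case
  proof eventually_elim
    case (elim \<omega>)
    let ?i = "increment (\<xi> (Suc n) \<omega>) (\<eta> (Suc n) \<omega>)"
    have "1 \<le> fst ?i + snd ?i"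
      using elim abc_pos by (auto simp: increment_def)
    hence "1 \<le> real (fst ?i) + real (snd ?i)" by linarith
    with elim show ?case by (simp add: colours_Suc ball_count_def)
  qed
qed

text \<open>The total is a random walk, and centring by its mean increment kills the cross term; n +
  2 is the centring index one step later.\<close>

lemma next_mean_total:
  "next_mean (\<lambda>y. (ball_count y - growth * (real n + 2))\<^sup>2) y =
    (ball_count y - growth * (real n + 1))\<^sup>2 + (p * (real a + real b - growth)\<^sup>2 + (1 - p) * (real c - growth)\<^sup>2)"
proof -
  define w where "w = ball_count y - growth * (real n + 1)"
  have "next_mean (\<lambda>y. (ball_count y - growth * (real n + 2))\<^sup>2) y =
      p * (w + (real a + real b - growth))\<^sup>2 + (1 - p) * (w + (real c - growth))\<^sup>2"
    by (simp add: next_mean_def ball_count_def w_def algebra_simps)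
  also have "p * (w + u)\<^sup>2 + (1 - p) * (w + v)\<^sup>2 =
      w\<^sup>2 + (p * u\<^sup>2 + (1 - p) * v\<^sup>2) + 2 * w * (p * u + (1 - p) * v)" for u v
    by (simp add: power2_sum algebra_simps)
  also have "p * (real a + real b - growth) + (1 - p) * (real c - growth) = 0"
    by (simp add: growth_def algebra_simps)
  finally show ?thesis by (simp add: w_def)
qed

text \<open>The drawn colour affects only the sign of the increment, so it enters through the linear
  term alone.\<close>

lemma next_mean_imbalance:
  "next_mean (\<lambda>y. (imbalance y)\<^sup>2) y =
    (imbalance y)\<^sup>2 + 2 * drift * growth * imbalance y * (2 * share y - 1) + step_var"
proof -
  define d z where "d = imbalance y" and "z = share y"
  have "next_mean (\<lambda>y. (imbalance y)\<^sup>2) y =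
      p * (z * (d + (real a - real b))\<^sup>2 + (1 - z) * (d - (real a - real b))\<^sup>2) +
      (1 - p) * (z * (d + real c)\<^sup>2 + (1 - z) * (d - real c)\<^sup>2)"
    by (simp add: next_mean_def imbalance_def d_def z_def algebra_simps)
  also have "\<dots> = d\<^sup>2 + 2 * (p * (real a - real b) + (1 - p) * real c) * d * (2 * z - 1) + step_var"
    unfolding step_var_def by (simp add: power2_eq_square algebra_simps)
  finally show ?thesis unfolding drift_growth[symmetric] d_def z_def by simp
qed

lemma total_second_moment:
  obtains K where "0 \<le> K" "\<And>n. (\<integral>\<omega>. (ball_count (colours n \<omega>) - growth * (real n + 1))\<^sup>2 \<partial>M) \<le> K * (real n + 1)"
proof -
  define v where "v = p * (real a + real b - growth)\<^sup>2 + (1 - p) * (real c - growth)\<^sup>2"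
  have v: "0 \<le> v" using p_pos p_less_1 by (simp add: v_def)
  define V where "V n = (\<integral>\<omega>. (ball_count (colours n \<omega>) - growth * (real n + 1))\<^sup>2 \<partial>M)" for n
  have V_Suc: "V (Suc n) = V n + v" for n
  proof -
    have "V (Suc n) = (\<integral>\<omega>. (\<lambda>y. (ball_count y - growth * (real n + 2))\<^sup>2) (colours (Suc n) \<omega>) \<partial>M)"
      by (simp add: V_def add.commute)
    also have "\<dots> = (\<integral>\<omega>. (\<lambda>y. (ball_count y - growth * (real n + 1))\<^sup>2) (colours n \<omega>) + v \<partial>M)"
      using expectation_colours_Suc_real[of "\<lambda>y. (ball_count y - growth * (real n + 2))\<^sup>2" n]
      unfolding next_mean_total v_def .
    also have "\<dots> = V n + v"
      unfolding V_def by (subst Bochner_Integration.integral_add)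
        (auto intro: integrable_colours[where f = "\<lambda>y. (ball_count y - growth * (real n + 1))\<^sup>2"] simp: prob_space)
    finally show ?thesis .
  qed
  have V0: "0 \<le> V 0" by (simp add: V_def)
  have "V n \<le> (V 0 + v) * (real n + 1)" for n
  proof (induction n)
    case (Suc n)
    thus ?case using V0 by (simp add: V_Suc algebra_simps)
  qed (use v in simp)
  with V0 v show ?thesis by (intro that[of "V 0 + v"]) (auto simp: V_def)
qed

text \<open>With rate 1 / (n + 1) in place of growth / T the second moment U would satisfy U(n + 1)
  = (1 + 2 drift / (n + 1)) U(n) + step_var, which grows linearly as 2 drift < 1. The error of the
  replacement is split between the gap below 1 and the second moment of the total.\<close>

lemma imbalance_second_moment:
  assumes "drift < 1 / 2"
  obtains K where "0 \<le> K" "\<And>n. (\<integral>\<omega>. (imbalance (colours n \<omega>))\<^sup>2 \<partial>M) \<le> K * (real n + 1)"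
proof -
  obtain W where W: "0 \<le> W" "\<And>n. (\<integral>\<omega>. (ball_count (colours n \<omega>) - growth * (real n + 1))\<^sup>2 \<partial>M) \<le> W * (real n + 1)"
    by (rule total_second_moment) blast
  define \<epsilon> where "\<epsilon> = (1 - 2 * drift) / 2"
  have \<epsilon>: "0 < \<epsilon>" "2 * drift + \<epsilon> < 1" using assms by (auto simp: \<epsilon>_def field_simps)
  define \<theta> where "\<theta> = max 0 (2 * drift + \<epsilon>)"
  have \<theta>: "0 \<le> \<theta>" "\<theta> < 1" "2 * drift + \<epsilon> \<le> \<theta>" using \<epsilon> by (auto simp: \<theta>_def)
  define U where "U n = (\<integral>\<omega>. (imbalance (colours n \<omega>))\<^sup>2 \<partial>M)" for n
  have U_nonneg: "0 \<le> U n" for n by (simp add: U_def)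
  \<comment> \<open>W / \<epsilon> is what remains of the term w^2 / (\<epsilon> (n + 1)) after
    integration.\<close>
  define C where "C = W / \<epsilon> + step_var"
  have C: "0 \<le> C" using W \<epsilon> step_var_pos by (simp add: C_def)
  have U_Suc: "U (Suc n) \<le> U n * (1 + \<theta> / (real n + 1)) + C" for n
  proof -
    let ?N = "real n + 1"
    let ?w = "\<lambda>y. ball_count y - growth * ?N"
    let ?g = "\<lambda>y. (imbalance y)\<^sup>2 * (1 + (2 * drift + \<epsilon>) / ?N) + (?w y)\<^sup>2 / (\<epsilon> * ?N) + step_var"
    have pointwise: "next_mean (\<lambda>y. (imbalance y)\<^sup>2) y \<le> ?g y" if y: "0 < ball_count y" for y
    proof -
      define d t w where "d = imbalance y" and "t = ball_count y" and "w = t - growth * ?N"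
      have dt: "\<bar>d\<bar> \<le> t" "0 < t" using abs_imbalance_le_total y by (auto simp: d_def t_def)
      \<comment> \<open>replacing \<open>growth / t\<close> by \<open>1 / (n + 1)\<close> costs only \<open>\<bar>d\<bar> \<bar>w\<bar> / (n + 1)\<close>, because \<open>\<bar>d\<bar> \<le> t\<close>\<close>
      have "d * (d / t) * w = d * (d / t) * t - growth * d * (d / t) * ?N"
        by (simp add: w_def t_def right_diff_distrib)
      moreover have "d * (d / t) * t = d\<^sup>2" using dt by (simp add: power2_eq_square)
      ultimately have "growth * d * (d / t) * ?N = d\<^sup>2 - d * (d / t) * w" by linarith
      hence "growth * d * (d / t) * ?N / ?N = (d\<^sup>2 - d * (d / t) * w) / ?N" by (rule arg_cong)
      hence eq: "growth * d * (d / t) = d\<^sup>2 / ?N - d * (d / t) * w / ?N"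
        unfolding diff_divide_distrib by (subst (asm) nonzero_mult_div_cancel_right) auto
      have "\<bar>d * (d / t) * w\<bar> \<le> \<bar>d\<bar> * 1 * \<bar>w\<bar>"
        unfolding abs_mult using dt by (intro mult_mono) (auto simp: abs_divide)
      moreover have "\<bar>d\<bar> * \<bar>w\<bar> * 2 \<le> \<epsilon> * d\<^sup>2 + w\<^sup>2 / \<epsilon>"
      proof -
        have "0 \<le> (\<epsilon> * \<bar>d\<bar> - \<bar>w\<bar>)\<^sup>2 / \<epsilon>" using \<epsilon> by simp
        also have "\<dots> = \<epsilon> * \<bar>d\<bar>\<^sup>2 - 2 * (\<bar>d\<bar> * \<bar>w\<bar>) + \<bar>w\<bar>\<^sup>2 / \<epsilon>"
          using \<epsilon>(1) by (simp add: field_simps power2_eq_square)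
        finally show ?thesis by simp
      qed
      moreover have "\<bar>drift * (d * (d / t) * w)\<bar> \<le> 1 * \<bar>d * (d / t) * w\<bar>"
        unfolding abs_mult[of drift] using drift_bounds by (intro mult_right_mono) auto
      ultimately have "- (2 * (drift * (d * (d / t) * w))) \<le> \<epsilon> * d\<^sup>2 + w\<^sup>2 / \<epsilon>" by linarith
      hence "- (2 * (drift * (d * (d / t) * w))) / ?N \<le> (\<epsilon> * d\<^sup>2 + w\<^sup>2 / \<epsilon>) / ?N"
        by (intro divide_right_mono) auto
      moreover have "2 * drift * growth * d * (d / t) = 2 * drift * d\<^sup>2 / ?N - (2 * (drift * (d * (d / t) * w))) / ?N"
      proof -
        have "2 * drift * growth * d * (d / t) = 2 * drift * (growth * d * (d / t))" by simp
        thus ?thesis unfolding eq by (simp add: right_diff_distrib)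
      qed
      moreover have "(\<epsilon> * d\<^sup>2 + w\<^sup>2 / \<epsilon>) / ?N = \<epsilon> * d\<^sup>2 / ?N + w\<^sup>2 / (\<epsilon> * ?N)"
        by (simp add: add_divide_distrib)
      moreover have "d\<^sup>2 * (1 + (2 * drift + \<epsilon>) / ?N) = d\<^sup>2 + 2 * drift * d\<^sup>2 / ?N + \<epsilon> * d\<^sup>2 / ?N"
        by (simp add: distrib_left distrib_right add_divide_distrib mult_ac)
      ultimately show ?thesis
        unfolding next_mean_imbalance share_eq_imbalance[OF y] d_def[symmetric] t_def[symmetric]
        unfolding w_def[symmetric] by linarith
    qed
    have "U (Suc n) = (\<integral>\<omega>. next_mean (\<lambda>y. (imbalance y)\<^sup>2) (colours n \<omega>) \<partial>M)"
      unfolding U_def by (rule expectation_colours_Suc_real)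
    also have "\<dots> \<le> (\<integral>\<omega>. ?g (colours n \<omega>) \<partial>M)"
      by (rule integral_mono[OF integrable_colours integrable_colours pointwise])
        (rule total_colours_pos)
    also have "\<dots> = U n * (1 + (2 * drift + \<epsilon>) / ?N) + (\<integral>\<omega>. (?w (colours n \<omega>))\<^sup>2 \<partial>M) / (\<epsilon> * ?N) + step_var"
    proof -
      have 1: "integrable M (\<lambda>\<omega>. (imbalance (colours n \<omega>))\<^sup>2 * (1 + (2 * drift + \<epsilon>) / ?N))"
        by (rule integrable_colours[where f = "\<lambda>y. (imbalance y)\<^sup>2 * (1 + (2 * drift + \<epsilon>) / ?N)"])
      have 2: "integrable M (\<lambda>\<omega>. (?w (colours n \<omega>))\<^sup>2 / (\<epsilon> * ?N))"
        by (rule integrable_colours[where f = "\<lambda>y. (?w y)\<^sup>2 / (\<epsilon> * ?N)"])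
      show ?thesis
        unfolding U_def using 1 2 by (simp add: prob_space)
    qed
    also have "\<dots> \<le> U n * (1 + \<theta> / ?N) + W * ?N / (\<epsilon> * ?N) + step_var"
      using \<theta>(3) W(2)[of n] \<epsilon> U_nonneg
      by (intro add_mono mult_left_mono divide_right_mono order_refl) auto
    also have "\<dots> = U n * (1 + \<theta> / ?N) + C" by (simp add: C_def)
    finally show ?thesis .
  qed
  \<comment> \<open>K (n + 1) is a supersolution once K \<theta> + C \<le> K; the summand
    \<open>U 0\<close> covers the start.\<close>
  define K where "K = U 0 + C / (1 - \<theta>)"
  have K: "0 \<le> K" "C \<le> K * (1 - \<theta>)"
    using U_nonneg C \<theta> by (auto simp: K_def distrib_right)
  have "U n \<le> K * (real n + 1)" for n
  proof (induction n)
    case 0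
    show ?case using C \<theta> by (simp add: K_def)
  next
    case (Suc n)
    have "U (Suc n) \<le> K * (real n + 1) * (1 + \<theta> / (real n + 1)) + C"
      using \<theta> by (intro order_trans[OF U_Suc] add_right_mono mult_right_mono Suc)
        (auto intro!: add_nonneg_nonneg)
    also have "\<dots> = K * (real n + 1) + K * \<theta> + C"
    proof -
      have "(real n + 1) * (1 + \<theta> / (real n + 1)) = real n + 1 + \<theta>"
        by (simp add: distrib_left)
      hence "K * (real n + 1) * (1 + \<theta> / (real n + 1)) = K * (real n + 1 + \<theta>)"
        by (simp only: mult.assoc)
      thus ?thesis by (simp only: distrib_left)
    qed
    also have "\<dots> \<le> K * (real (Suc n) + 1)" using K by (simp add: algebra_simps)
    finally show ?case .
  qed
  with K show ?thesis by (intro that[of K]) (auto simp: U_def)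
qed

section \<open>Characteristic functions\<close>

text \<open>The conditional characteristic function of an increment of the imbalance when type 1 is
  drawn; for type 2 the increment changes sign, so the argument becomes -x.\<close>

definition step_char :: "real \<Rightarrow> complex" where
  "step_char x = p * iexp (x * (real a - real b)) + (1 - p) * iexp (x * real c)"

lemma next_mean_iexp:
  "next_mean (\<lambda>y. iexp (x * imbalance y)) y =
    iexp (x * imbalance y) * (share y * step_char x + (1 - share y) * step_char (- x))"
proof -
  have "iexp (x * (d + e)) = iexp (x * d) * iexp (x * e)" for d e
    by (simp add: distrib_left flip: exp_add)
  moreover have "imbalance (fst y + a, snd y + b) = imbalance y + (real a - real b)"
    "imbalance (fst y + b, snd y + a) = imbalance y + - (real a - real b)"
    "imbalance (fst y + c, snd y) = imbalance y + real c"
    "imbalance (fst y, snd y + c) = imbalance y + - real c"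
    by (simp_all add: imbalance_def)
  moreover have "iexp (x * - e) = iexp (- x * e)" for e by simp
  ultimately have "iexp (x * imbalance (fst y + a, snd y + b)) = iexp (x * imbalance y) * iexp (x * (real a - real b))"
    "iexp (x * imbalance (fst y + b, snd y + a)) = iexp (x * imbalance y) * iexp (- x * (real a - real b))"
    "iexp (x * imbalance (fst y + c, snd y)) = iexp (x * imbalance y) * iexp (x * real c)"
    "iexp (x * imbalance (fst y, snd y + c)) = iexp (x * imbalance y) * iexp (- x * real c)"
    by (simp_all only:)
  thus ?thesis
    unfolding next_mean_def step_char_def by (simp add: scaleR_conv_of_real algebra_simps)
qed

lemma step_char_approx:
  obtains K where "0 \<le> K"
    "\<And>x. cmod (step_char x - (1 + \<i> * (x * (drift * growth)) - step_var * x\<^sup>2 / 2)) \<le> K * \<bar>x\<bar> ^ 3"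
proof -
  define K where "K = p * (\<bar>real a - real b\<bar> ^ 3 / 6) + (1 - p) * (\<bar>real c\<bar> ^ 3 / 6)"
  have K: "0 \<le> K" using p_pos p_less_1 by (simp add: K_def)
  have "cmod (step_char x - (1 + \<i> * (x * (drift * growth)) - step_var * x\<^sup>2 / 2)) \<le> K * \<bar>x\<bar> ^ 3" for x
  proof -
    define u where "u = real a - real b"
    define r where "r z = iexp (x * z) - (1 + \<i> * (x * z) - (x * z)\<^sup>2 / 2)" for z
    have r: "cmod (r z) \<le> \<bar>z\<bar> ^ 3 / 6 * \<bar>x\<bar> ^ 3" for z
      using iexp_second_order[of "x * z"] by (simp add: r_def abs_mult power_mult_distrib mult.commute)
    have "step_char x - (1 + \<i> * (x * (drift * growth)) - step_var * x\<^sup>2 / 2) =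
        p * r (real a - real b) + (1 - p) * r (real c)"
      unfolding drift_growth step_char_def step_var_def r_def u_def[symmetric]
      by (simp add: power_mult_distrib field_simps)
    also have "cmod \<dots> \<le> cmod (p * r (real a - real b)) + cmod ((1 - p) * r (real c))"
      by (rule norm_triangle_ineq)
    also have "\<dots> = p * cmod (r (real a - real b)) + (1 - p) * cmod (r (real c))"
      unfolding norm_mult norm_of_real using p_pos p_less_1 by simp
    also have "\<dots> \<le> p * (\<bar>real a - real b\<bar> ^ 3 / 6 * \<bar>x\<bar> ^ 3) + (1 - p) * (\<bar>real c\<bar> ^ 3 / 6 * \<bar>x\<bar> ^ 3)"
      using p_pos p_less_1 by (intro add_mono mult_left_mono r) auto
    also have "\<dots> = K * \<bar>x\<bar> ^ 3" by (simp add: K_def algebra_simps)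
    finally show ?thesis .
  qed
  with K show ?thesis by (rule that)
qed

definition imbalance_char :: "nat \<Rightarrow> real \<Rightarrow> complex" where
  "imbalance_char n x = (\<integral>\<omega>. iexp (x * imbalance (colours n \<omega>)) \<partial>M)"

lemma second_moments:
  assumes "drift < 1 / 2"
  obtains K where "0 \<le> K"
    "\<And>n. (\<integral>\<omega>. (imbalance (colours n \<omega>))\<^sup>2 \<partial>M) \<le> K * (real n + 1)"
    "\<And>n. (\<integral>\<omega>. (ball_count (colours n \<omega>) - growth * (real n + 1))\<^sup>2 \<partial>M) \<le> K * (real n + 1)"
proof -
  obtain K1 where K1: "0 \<le> K1" "\<And>n. (\<integral>\<omega>. (imbalance (colours n \<omega>))\<^sup>2 \<partial>M) \<le> K1 * (real n + 1)"
    using imbalance_second_moment[OF assms] by blast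
  obtain K2 where K2: "0 \<le> K2" "\<And>n. (\<integral>\<omega>. (ball_count (colours n \<omega>) - growth * (real n + 1))\<^sup>2 \<partial>M) \<le> K2 * (real n + 1)"
    by (rule total_second_moment) blast
  show ?thesis
  proof (rule that[of "max K1 K2"])
    show "(\<integral>\<omega>. (imbalance (colours n \<omega>))\<^sup>2 \<partial>M) \<le> max K1 K2 * (real n + 1)" for n
      by (rule order_trans[OF K1(2)]) (intro mult_right_mono, auto)
    show "(\<integral>\<omega>. (ball_count (colours n \<omega>) - growth * (real n + 1))\<^sup>2 \<partial>M) \<le> max K1 K2 * (real n + 1)" for n
      by (rule order_trans[OF K2(2)]) (intro mult_right_mono, auto)
  qed (use K1 in auto)
qed

text \<open>After the unimodular factor \<open>iexp (x * imbalance y)\<close> is split off, both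
  sides are compared with 1 + i s - u, where s contains the true rate growth / t and q the
  substitute 1 / N. The bound is arranged so that everything depending on the state is a
  second-moment quantity over N^2.\<close>

lemma next_mean_iexp_approx:
  fixes n :: nat and x :: real
  defines "r \<equiv> 1 + drift / (real n + 1)"
  assumes K: "\<And>x. cmod (step_char x - (1 + \<i> * (x * (drift * growth)) - step_var * x\<^sup>2 / 2)) \<le> K * \<bar>x\<bar> ^ 3"
    and y: "real n + 1 \<le> ball_count y" and x: "\<bar>x\<bar> \<le> 1"
  shows "cmod (next_mean (\<lambda>y. iexp (x * imbalance y)) y
      - exp (- step_var * x\<^sup>2 / 2) * iexp (x * r * imbalance y))
    \<le> (K + step_var\<^sup>2) * \<bar>x\<bar> ^ 3 + 2 * \<bar>x\<bar> / (real n + 1)\<^sup>2 *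
      ((imbalance y)\<^sup>2 + (ball_count y - growth * (real n + 1))\<^sup>2)"
proof -
  define N d t w z where "N = real n + 1" and "d = imbalance y" and "t = ball_count y"
    and "w = t - growth * N" and "z = share y"
  define u where "u = step_var * x\<^sup>2 / 2"
  define s q where "s = x * (drift * growth) * (d / t)" and "q = x * drift * d / N"
  have N: "0 < N" "N \<le> t" using y by (auto simp: N_def t_def)
  have u: "0 \<le> u" using step_var_pos by (simp add: u_def)
  have z: "0 \<le> z" "z \<le> 1" "2 * z - 1 = d / t"
    using share_bounds share_eq_imbalance[of y] N by (auto simp: z_def d_def t_def)
  let ?Q = "z * step_char x + (1 - z) * step_char (- x)"
  have Q: "cmod (?Q - (1 + \<i> * s - u)) \<le> K * \<bar>x\<bar> ^ 3"
  proof -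
    let ?e = "\<lambda>x. step_char x - (1 + \<i> * (x * (drift * growth)) - step_var * x\<^sup>2 / 2)"
    have "?Q - (1 + \<i> * s - u) = z * ?e x + (1 - z) * ?e (- x)"
    proof -
      define B V where "B = complex_of_real (x * (drift * growth))" and "V = complex_of_real u"
      have "complex_of_real s = B * (2 * z - 1)" unfolding s_def z(3)[symmetric] B_def by simp
      moreover have "?e x = step_char x - (1 + \<i> * B - V)" "?e (- x) = step_char (- x) - (1 - \<i> * B - V)"
        unfolding B_def V_def u_def by simp_all
      moreover have "?Q - (1 + \<i> * (B * (2 * z - 1)) - V) =
          z * (step_char x - (1 + \<i> * B - V)) + (1 - z) * (step_char (- x) - (1 - \<i> * B - V))"
        by (simp add: algebra_simps)
      ultimately show ?thesis unfolding V_def[symmetric] by (simp only:)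
    qed
    also have "cmod \<dots> \<le> cmod (z * ?e x) + cmod ((1 - z) * ?e (- x))"
      by (rule norm_triangle_ineq)
    also have "\<dots> = z * cmod (?e x) + (1 - z) * cmod (?e (- x))"
      unfolding norm_mult norm_of_real using z by simp
    also have "\<dots> \<le> z * (K * \<bar>x\<bar> ^ 3) + (1 - z) * (K * \<bar>- x\<bar> ^ 3)"
      using z by (intro add_mono mult_left_mono K) auto
    finally show ?thesis by (simp add: algebra_simps)
  qed
  have E: "cmod (iexp q * exp (- u) - (1 + \<i> * s - u)) \<le> q\<^sup>2 + 2 * u\<^sup>2 + \<bar>q - s\<bar>"
    by (rule iexp_times_exp_approx[OF u])
  have qs: "q - s = x * drift * ((d / t) * w / N)"
    using N by (simp add: q_def s_def w_def field_simps)
  \<comment> \<open>Here |d| / t is bounded by |d| / N instead of 1, using N \<le> t: this gains the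
    second factor 1 / N.\<close>
  have "\<bar>q - s\<bar> \<le> \<bar>x\<bar> * 1 * (\<bar>d\<bar> / N * \<bar>w\<bar> / N)"
    unfolding qs abs_mult abs_divide using drift_bounds N
    by (intro mult_mono divide_mono) auto
  also have "\<dots> = \<bar>x\<bar> / N\<^sup>2 * (\<bar>d\<bar> * \<bar>w\<bar>)"
    by (simp add: power2_eq_square)
  also have "\<dots> \<le> \<bar>x\<bar> / N\<^sup>2 * (d\<^sup>2 + w\<^sup>2)"
  proof (intro mult_left_mono)
    have "0 \<le> (\<bar>d\<bar> - \<bar>w\<bar>)\<^sup>2" by simp
    hence "2 * (\<bar>d\<bar> * \<bar>w\<bar>) \<le> d\<^sup>2 + w\<^sup>2" by (simp add: power2_diff)
    moreover have "0 \<le> \<bar>d\<bar> * \<bar>w\<bar>" by simp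
    ultimately show "\<bar>d\<bar> * \<bar>w\<bar> \<le> d\<^sup>2 + w\<^sup>2" by linarith
  qed auto
  finally have qs_le: "\<bar>q - s\<bar> \<le> \<bar>x\<bar> / N\<^sup>2 * (d\<^sup>2 + w\<^sup>2)" .
  have q_le: "q\<^sup>2 \<le> \<bar>x\<bar> / N\<^sup>2 * (d\<^sup>2 + w\<^sup>2)"
  proof -
    \<comment> \<open>One of the two factors |x| is given up, as |x| \<le> 1, so that this error has
      the same shape as the previous one.\<close>
    have "q\<^sup>2 = (\<bar>x\<bar> * (\<bar>x\<bar> * drift\<^sup>2)) * (d\<^sup>2 / N\<^sup>2)"
      by (simp add: q_def power_mult_distrib power_divide mult.assoc flip: power2_eq_square)
    also have "\<dots> \<le> (\<bar>x\<bar> * (1 * 1)) * (d\<^sup>2 / N\<^sup>2)"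
      using drift_bounds x by (intro mult_right_mono mult_left_mono mult_mono) (auto simp: abs_square_le_1)
    also have "\<dots> \<le> \<bar>x\<bar> / N\<^sup>2 * (d\<^sup>2 + w\<^sup>2)"
      by (simp add: distrib_left)
    finally show ?thesis .
  qed
  have u_le: "2 * u\<^sup>2 \<le> step_var\<^sup>2 * \<bar>x\<bar> ^ 3"
  proof -
    have "2 * u\<^sup>2 = step_var\<^sup>2 * (\<bar>x\<bar> ^ 3 * (\<bar>x\<bar> / 2))"
      by (simp add: u_def power_mult_distrib power_divide power2_eq_square power3_eq_cube)
    also have "\<dots> \<le> step_var\<^sup>2 * (\<bar>x\<bar> ^ 3 * 1)"
      using x by (intro mult_left_mono) auto
    finally show ?thesis by simp
  qed
  have triangle: "cmod (A - B) \<le> cmod (A - Z) + cmod (B - Z)" for A B Z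
    using norm_triangle_ineq4[of "A - Z" "B - Z"] by simp
  have "next_mean (\<lambda>y. iexp (x * imbalance y)) y - exp (- step_var * x\<^sup>2 / 2) * iexp (x * r * imbalance y)
      = iexp (x * d) * (?Q - iexp q * exp (- u))"
  proof -
    have "iexp (x * r * d) = iexp (x * d) * iexp q"
      by (simp add: r_def q_def N_def distrib_left distrib_right flip: exp_add)
    thus ?thesis
      unfolding next_mean_iexp d_def[symmetric] z_def[symmetric] u_def
      by (simp add: right_diff_distrib)
  qed
  hence "cmod (next_mean (\<lambda>y. iexp (x * imbalance y)) y - exp (- step_var * x\<^sup>2 / 2) * iexp (x * r * imbalance y))
      = cmod (?Q - iexp q * exp (- u))"
    by (simp add: norm_mult)
  also have "\<dots> \<le> cmod (?Q - (1 + \<i> * s - u)) + cmod (iexp q * exp (- u) - (1 + \<i> * s - u))"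
    by (rule triangle)
  also have "\<dots> \<le> K * \<bar>x\<bar> ^ 3 + (q\<^sup>2 + 2 * u\<^sup>2 + \<bar>q - s\<bar>)"
    by (intro add_mono Q E)
  also have "\<dots> \<le> (K + step_var\<^sup>2) * \<bar>x\<bar> ^ 3 + 2 * \<bar>x\<bar> / N\<^sup>2 * (d\<^sup>2 + w\<^sup>2)"
    using qs_le q_le u_le by (simp add: distrib_right)
  finally show ?thesis unfolding N_def d_def w_def t_def .
qed

text \<open>Integrating the pointwise estimate turns second moments of order n + 1, divided by (n +
  1)^2, into the error |x| / (n + 1).\<close>

lemma imbalance_char_step:
  assumes "drift < 1 / 2"
  obtains C where "0 \<le> C"
    "\<And>n x. \<bar>x\<bar> \<le> 1 \<Longrightarrow> cmod (imbalance_char (Suc n) x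
      - exp (- step_var * x\<^sup>2 / 2) * imbalance_char n (x * (1 + drift / (real n + 1))))
      \<le> C * (\<bar>x\<bar> ^ 3 + \<bar>x\<bar> / (real n + 1))"
proof -
  obtain K where K: "0 \<le> K"
    "\<And>x. cmod (step_char x - (1 + \<i> * (x * (drift * growth)) - step_var * x\<^sup>2 / 2)) \<le> K * \<bar>x\<bar> ^ 3"
    by (rule step_char_approx) blast
  obtain V where V: "0 \<le> V"
    "\<And>n. (\<integral>\<omega>. (imbalance (colours n \<omega>))\<^sup>2 \<partial>M) \<le> V * (real n + 1)"
    "\<And>n. (\<integral>\<omega>. (ball_count (colours n \<omega>) - growth * (real n + 1))\<^sup>2 \<partial>M) \<le> V * (real n + 1)"
    using second_moments[OF assms] by blast
  define C where "C = K + step_var\<^sup>2 + 4 * V"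
  have C: "0 \<le> C" "K + step_var\<^sup>2 \<le> C" "4 * V \<le> C" using K(1) V(1) by (auto simp: C_def)
  have "cmod (imbalance_char (Suc n) x
      - exp (- step_var * x\<^sup>2 / 2) * imbalance_char n (x * (1 + drift / (real n + 1))))
      \<le> C * (\<bar>x\<bar> ^ 3 + \<bar>x\<bar> / (real n + 1))" if x: "\<bar>x\<bar> \<le> 1" for n x
  proof -
    let ?N = "real n + 1" and ?r = "1 + drift / (real n + 1)"
    define e where "e = exp (- step_var * x\<^sup>2 / 2)"
    define F where "F y = next_mean (\<lambda>y. iexp (x * imbalance y)) y - e * iexp (x * ?r * imbalance y)" for y
    let ?g = "\<lambda>y. (imbalance y)\<^sup>2" and ?h = "\<lambda>y. (ball_count y - growth * ?N)\<^sup>2"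
    define G where "G y = (K + step_var\<^sup>2) * \<bar>x\<bar> ^ 3 + 2 * \<bar>x\<bar> / ?N\<^sup>2 * (?g y + ?h y)" for y
    have "imbalance_char (Suc n) x - e * imbalance_char n (x * ?r) =
        (\<integral>\<omega>. next_mean (\<lambda>y. iexp (x * imbalance y)) (colours n \<omega>) \<partial>M)
        - (\<integral>\<omega>. e * iexp (x * ?r * imbalance (colours n \<omega>)) \<partial>M)"
      unfolding imbalance_char_def
      using expectation_colours_Suc_complex[of "\<lambda>y. iexp (x * imbalance y)" n] by simp
    also have "\<dots> = (\<integral>\<omega>. F (colours n \<omega>) \<partial>M)"
      unfolding F_def
      by (rule Bochner_Integration.integral_diff[OF integrable_colours
            integrable_colours[where f = "\<lambda>y. e * iexp (x * ?r * imbalance y)"], symmetric])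
    finally have "cmod (imbalance_char (Suc n) x - e * imbalance_char n (x * ?r)) = cmod (\<integral>\<omega>. F (colours n \<omega>) \<partial>M)"
      by (rule arg_cong)
    also have "\<dots> \<le> (\<integral>\<omega>. cmod (F (colours n \<omega>)) \<partial>M)"
      by (rule integral_norm_bound)
    also have "\<dots> \<le> (\<integral>\<omega>. G (colours n \<omega>) \<partial>M)"
    proof (rule integral_mono_AE)
      show "AE \<omega> in M. cmod (F (colours n \<omega>)) \<le> G (colours n \<omega>)"
        using AE_total_colours_ge[of n] unfolding F_def G_def e_def
        by eventually_elim (rule next_mean_iexp_approx[OF K(2) _ x])
    qed (rule integrable_colours[where f = "\<lambda>y. cmod (F y)"] integrable_colours[where f = G])+
    also have "\<dots> = (K + step_var\<^sup>2) * \<bar>x\<bar> ^ 3 + 2 * \<bar>x\<bar> / ?N\<^sup>2 *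
        ((\<integral>\<omega>. ?g (colours n \<omega>) \<partial>M) + (\<integral>\<omega>. ?h (colours n \<omega>) \<partial>M))"
      using integrable_colours[where f = ?g] integrable_colours[where f = ?h]
      by (simp add: prob_space G_def)
    also have "\<dots> \<le> (K + step_var\<^sup>2) * \<bar>x\<bar> ^ 3 + 2 * \<bar>x\<bar> / ?N\<^sup>2 * (V * ?N + V * ?N)"
      by (intro add_left_mono mult_left_mono add_mono V) auto
    also have "2 * \<bar>x\<bar> / ?N\<^sup>2 * (V * ?N + V * ?N) = 4 * V * (\<bar>x\<bar> / ?N)"
      by (simp add: power2_eq_square)
    also have "(K + step_var\<^sup>2) * \<bar>x\<bar> ^ 3 + 4 * V * (\<bar>x\<bar> / ?N) \<le> C * \<bar>x\<bar> ^ 3 + C * (\<bar>x\<bar> / ?N)"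
      by (intro add_mono mult_right_mono C) auto
    finally show ?thesis unfolding e_def by (simp only: distrib_left)
  qed
  with C(1) show ?thesis by (rule that)
qed

text \<open>One step back in time rescales x, so the induction runs over all arguments at once.
  Gaussian factors are at most 1, hence one-step errors merely add up, each at its own argument; the
  condition on \<open>growth_seq\<close> keeps these arguments in [-1, 1], where the one-step
  estimate is valid.\<close>

lemma imbalance_char_approx:
  assumes drift: "drift < 1 / 2"
  obtains C where "0 \<le> C"
    "\<And>n x. \<bar>x\<bar> * growth_seq drift n \<le> 1 \<Longrightarrow>
      cmod (imbalance_char n x - exp (- step_var * x\<^sup>2 * variance_seq drift n / 2))
      \<le> C * (\<bar>x\<bar> ^ 3 * growth_seq drift n * variance_seq drift n + \<bar>x\<bar> * drift_error_seq drift n)"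
proof -
  obtain C0 where C0: "0 \<le> C0"
    "\<And>n x. \<bar>x\<bar> \<le> 1 \<Longrightarrow> cmod (imbalance_char (Suc n) x
      - exp (- step_var * x\<^sup>2 / 2) * imbalance_char n (x * (1 + drift / (real n + 1))))
      \<le> C0 * (\<bar>x\<bar> ^ 3 + \<bar>x\<bar> / (real n + 1))"
    using imbalance_char_step[OF drift] by blast
  define C where "C = C0 + \<bar>imbalance (y1, y2)\<bar>"
  have C: "0 \<le> C" "C0 \<le> C" "\<bar>imbalance (y1, y2)\<bar> \<le> C" using C0(1) by (auto simp: C_def)
  let ?A = "variance_seq drift" and ?R = "drift_error_seq drift" and ?H = "growth_seq drift"
  have "cmod (imbalance_char n x - exp (- step_var * x\<^sup>2 * ?A n / 2))
      \<le> C * (\<bar>x\<bar> ^ 3 * ?H n * ?A n + \<bar>x\<bar> * ?R n)" if "\<bar>x\<bar> * ?H n \<le> 1" for n x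
    using that
  proof (induction n arbitrary: x)
    case 0
    \<comment> \<open>The initial imbalance contributes an error linear in x. It is covered by the
      start value 1 of \<open>drift_error_seq\<close> and by its share in \<open>C\<close>.\<close>
    have "imbalance_char 0 x = (\<integral>\<omega>. iexp (x * imbalance (y1, y2)) \<partial>M)"
      unfolding imbalance_char_def by (rule Bochner_Integration.integral_cong) (auto simp: colours_0)
    also have "\<dots> = iexp (x * imbalance (y1, y2))" by (simp add: prob_space)
    finally have "imbalance_char 0 x - exp (- step_var * x\<^sup>2 * ?A 0 / 2) = iexp (x * imbalance (y1, y2)) - iexp 0"
      by simp
    also have "cmod \<dots> \<le> \<bar>x\<bar> * \<bar>imbalance (y1, y2)\<bar>"
      using iexp_diff_le[of "x * imbalance (y1, y2)" 0] by (simp add: abs_mult)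
    also have "\<dots> \<le> \<bar>x\<bar> * C" by (intro mult_left_mono C) auto
    finally show ?case by (simp add: mult.commute)
  next
    case (Suc n)
    let ?N = "real n + 1"
    define r where "r = 1 + drift / ?N"
    define g where "g = exp (- step_var * x\<^sup>2 / 2)"
    have r: "0 \<le> r" unfolding r_def by (rule step_factor_nonneg) (rule drift_bounds)
    have rH: "r * ?H n \<le> ?H (Suc n)"
      using growth_seq_ge_1[of drift n] by (auto simp: r_def mult.commute intro!: mult_left_mono divide_right_mono)
    have "\<bar>x\<bar> * 1 \<le> \<bar>x\<bar> * ?H (Suc n)" by (intro mult_left_mono growth_seq_ge_1) auto
    hence x: "\<bar>x\<bar> \<le> 1" using Suc.prems by simp
    have "\<bar>x * r\<bar> * ?H n = \<bar>x\<bar> * (r * ?H n)" using r by (simp add: abs_mult)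
    also have "\<dots> \<le> \<bar>x\<bar> * ?H (Suc n)" by (intro mult_left_mono rH) auto
    finally have "\<bar>x * r\<bar> * ?H n \<le> 1" using Suc.prems by simp
    from Suc.IH[OF this]
    have IH: "cmod (imbalance_char n (x * r) - exp (- step_var * (x * r)\<^sup>2 * ?A n / 2))
        \<le> C * (\<bar>x\<bar> ^ 3 * (r ^ 3 * ?H n * ?A n) + \<bar>x\<bar> * (r * ?R n))"
      using r by (simp add: abs_mult power_mult_distrib mult_ac)
    have g: "0 \<le> g" "g \<le> 1" using step_var_pos by (auto simp: g_def)
    have eq: "exp (- step_var * x\<^sup>2 * ?A (Suc n) / 2) = g * exp (- step_var * (x * r)\<^sup>2 * ?A n / 2)"
    proof -
      have "?A (Suc n) = ?A n * r\<^sup>2 + 1" by (simp add: r_def)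
      hence "- step_var * x\<^sup>2 * ?A (Suc n) / 2 = - step_var * x\<^sup>2 / 2 + - step_var * (x * r)\<^sup>2 * ?A n / 2"
        by (simp only: power_mult_distrib) (simp add: field_simps)
      thus ?thesis unfolding g_def by (simp only: exp_add)
    qed
    have "imbalance_char (Suc n) x - exp (- step_var * x\<^sup>2 * ?A (Suc n) / 2) =
        (imbalance_char (Suc n) x - g * imbalance_char n (x * r)) +
        g * (imbalance_char n (x * r) - exp (- step_var * (x * r)\<^sup>2 * ?A n / 2))"
      unfolding eq by (simp add: right_diff_distrib)
    also have "cmod \<dots> \<le> cmod (imbalance_char (Suc n) x - g * imbalance_char n (x * r)) +
        cmod (g * (imbalance_char n (x * r) - exp (- step_var * (x * r)\<^sup>2 * ?A n / 2)))"
      by (rule norm_triangle_ineq)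
    also have "\<dots> \<le> C * (\<bar>x\<bar> ^ 3 + \<bar>x\<bar> / ?N) + C * (\<bar>x\<bar> ^ 3 * (r ^ 3 * ?H n * ?A n) + \<bar>x\<bar> * (r * ?R n))"
    proof (rule add_mono)
      show "cmod (imbalance_char (Suc n) x - g * imbalance_char n (x * r)) \<le> C * (\<bar>x\<bar> ^ 3 + \<bar>x\<bar> / ?N)"
        using C0(2)[OF x, of n] unfolding g_def r_def
        by (rule order_trans) (intro mult_right_mono C, auto)
      have "cmod (g * (imbalance_char n (x * r) - exp (- step_var * (x * r)\<^sup>2 * ?A n / 2))) =
          g * cmod (imbalance_char n (x * r) - exp (- step_var * (x * r)\<^sup>2 * ?A n / 2))"
        using g by (simp add: norm_mult)
      also have "\<dots> \<le> 1 * cmod (imbalance_char n (x * r) - exp (- step_var * (x * r)\<^sup>2 * ?A n / 2))"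
        by (intro mult_right_mono g) auto
      finally show "cmod (g * (imbalance_char n (x * r) - exp (- step_var * (x * r)\<^sup>2 * ?A n / 2)))
          \<le> C * (\<bar>x\<bar> ^ 3 * (r ^ 3 * ?H n * ?A n) + \<bar>x\<bar> * (r * ?R n))"
        using IH by simp
    qed
    also have "\<dots> = C * (\<bar>x\<bar> ^ 3 * (r ^ 3 * ?H n * ?A n + 1) + \<bar>x\<bar> * (r * ?R n + 1 / ?N))"
      by (simp add: algebra_simps)
    also have "\<dots> \<le> C * (\<bar>x\<bar> ^ 3 * (?H (Suc n) * ?A (Suc n)) + \<bar>x\<bar> * ?R (Suc n))"
    proof (intro mult_left_mono add_mono C(1))
      \<comment> \<open>The cubic error is multiplied by r^3: two factors drive
        \<open>variance_seq\<close>, the third goes to \<open>growth_seq\<close>, whose lower bound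
        1 pays for the fresh error.\<close>
      have "r ^ 3 * ?H n * ?A n + 1 = (r * ?H n) * (?A n * r\<^sup>2) + 1 * 1"
        by (simp add: power2_eq_square power3_eq_cube)
      also have "\<dots> \<le> ?H (Suc n) * (?A n * r\<^sup>2) + ?H (Suc n) * 1"
        using variance_seq_nonneg[of drift n] growth_seq_ge_1[of drift "Suc n"]
        by (intro add_mono mult_right_mono rH) auto
      also have "\<dots> = ?H (Suc n) * ?A (Suc n)" by (simp add: r_def distrib_left)
      finally show "r ^ 3 * ?H n * ?A n + 1 \<le> ?H (Suc n) * ?A (Suc n)" .
      show "r * ?R n + 1 / ?N \<le> ?R (Suc n)" by (simp add: r_def mult.commute)
    qed auto
    finally show ?case by (simp add: mult.assoc)
  qed
  with C(1) show ?thesis by (rule that)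
qed

text \<open>\<open>growth_seq\<close> being o(sqrt n) has two effects: it makes the argument
  eventually admissible, and it kills the cubic error, since n steps at |x|^3 = O(n^(-3/2)) leave
  just \<open>growth_seq\<close> over sqrt n.\<close>

lemma imbalance_char_lim:
  assumes drift: "drift < 1 / 2"
  shows "(\<lambda>n. imbalance_char n (s / sqrt (real n))) \<longlonglongrightarrow> exp (- step_var * s\<^sup>2 * (1 / (1 - 2 * drift)) / 2)"
proof -
  let ?A = "variance_seq drift" and ?R = "drift_error_seq drift" and ?H = "growth_seq drift"
  obtain C where C: "0 \<le> C"
    "\<And>n x. \<bar>x\<bar> * ?H n \<le> 1 \<Longrightarrow>
      cmod (imbalance_char n x - exp (- step_var * x\<^sup>2 * ?A n / 2))
      \<le> C * (\<bar>x\<bar> ^ 3 * ?H n * ?A n + \<bar>x\<bar> * ?R n)"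
    using imbalance_char_approx[OF drift] by blast
  let ?x = "\<lambda>n. s / sqrt (real n)"
  note A = variance_seq_lim[OF drift] and H = growth_seq_lim[OF drift]
    and R = drift_error_seq_lim[OF drift_bounds(1) drift]
  have "(\<lambda>n. \<bar>s\<bar> * (?H n / sqrt (real n))) \<longlonglongrightarrow> \<bar>s\<bar> * 0"
    by (intro tendsto_mult tendsto_const H)
  hence "eventually (\<lambda>n. \<bar>s\<bar> * (?H n / sqrt (real n)) < 1) sequentially"
    by (rule order_tendstoD) simp
  hence ev: "eventually (\<lambda>n. cmod (imbalance_char n (?x n) - exp (- step_var * s\<^sup>2 * (?A n / real n) / 2))
      \<le> C * (\<bar>s\<bar> ^ 3 * (?H n / sqrt (real n)) * (?A n / real n) + \<bar>s\<bar> * (?R n / sqrt (real n)))) sequentially"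
  proof eventually_elim
    case (elim n)
    hence "\<bar>?x n\<bar> * ?H n \<le> 1" by (simp add: abs_divide)
    from C(2)[OF this] show ?case
      by (simp add: power_divide power3_eq_cube mult_ac)
  qed
  have "(\<lambda>n. C * (\<bar>s\<bar> ^ 3 * (?H n / sqrt (real n)) * (?A n / real n) + \<bar>s\<bar> * (?R n / sqrt (real n))))
      \<longlonglongrightarrow> C * (\<bar>s\<bar> ^ 3 * 0 * (1 / (1 - 2 * drift)) + \<bar>s\<bar> * 0)"
    by (intro tendsto_intros A H R)
  hence "(\<lambda>n. C * (\<bar>s\<bar> ^ 3 * (?H n / sqrt (real n)) * (?A n / real n) + \<bar>s\<bar> * (?R n / sqrt (real n)))) \<longlonglongrightarrow> 0"
    by simp
  with ev have "(\<lambda>n. imbalance_char n (?x n) - exp (- step_var * s\<^sup>2 * (?A n / real n) / 2)) \<longlonglongrightarrow> 0"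
    by (rule Lim_null_comparison)
  moreover have "(\<lambda>n. complex_of_real (exp (- step_var * s\<^sup>2 * (?A n / real n) / 2)))
      \<longlonglongrightarrow> complex_of_real (exp (- step_var * s\<^sup>2 * (1 / (1 - 2 * drift)) / 2))"
    by (intro tendsto_of_real tendsto_exp tendsto_divide tendsto_mult tendsto_const A) simp
  ultimately show ?thesis by (rule Lim_transform[rotated])
qed

section \<open>From the imbalance to the proportion of type 1\<close>

lemma urn_proportion_eq: "urn_proportion Y1 Y2 n \<omega> = share (colours n \<omega>)"
  by (simp add: urn_proportion_def urn_total_def share_def colours_def)

text \<open>Replacing the random denominator k by growth n costs |d| |growth n - k| over a multiple
  of k sqrt n. The product is bounded by squares and k by n from below, so that only known second
  moments remain.\<close>

lemma scaled_deviation_approx: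
  assumes n: "0 < n" and y: "real n + 1 \<le> ball_count y"
  shows "\<bar>t * (sqrt (real n) * (share y - 1 / 2)) - t / (2 * growth) / sqrt (real n) * imbalance y\<bar>
    \<le> \<bar>t\<bar> / (2 * growth * (real n * sqrt (real n))) *
      ((imbalance y)\<^sup>2 + 2 * (ball_count y - growth * (real n + 1))\<^sup>2 + 2 * growth\<^sup>2)"
proof -
  define N r d k w where "N = real n" and "r = sqrt N" and "d = imbalance y" and "k = ball_count y"
    and "w = k - growth * (N + 1)"
  have N: "0 < N" "0 < r" "N \<le> k" "0 < k" "N = r * r" using n y by (auto simp: N_def k_def r_def)
  have g: "0 < growth" by (rule growth_pos)
  have share: "share y - 1 / 2 = d / k / 2"
    using share_eq_imbalance[of y] N unfolding d_def k_def by simp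
  have "t * (r * (d / k / 2)) - t / (2 * growth) / r * d = t * d * (growth * (r * r) - k) / (2 * growth * (k * r))"
    using N(2,4) g by (simp add: field_simps)
  hence "\<bar>t * (r * (d / k / 2)) - t / (2 * growth) / r * d\<bar> = \<bar>t\<bar> * (\<bar>d\<bar> * \<bar>growth * N - k\<bar>) / (2 * growth * (k * r))"
    using N g by (simp add: abs_mult abs_divide)
  also have "\<dots> \<le> \<bar>t\<bar> * (d\<^sup>2 + 2 * w\<^sup>2 + 2 * growth\<^sup>2) / (2 * growth * (N * r))"
  proof (intro frac_le mult_left_mono mult_right_mono)
    \<comment> \<open>The second moment of the total is centred at growth (n + 1), the normalisation
      at growth n; the shift by one step produces the summand 2 growth^2.\<close>
    have "\<bar>growth * N - k\<bar>\<^sup>2 = (w + growth)\<^sup>2"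
      unfolding power2_abs by (subst power2_commute) (simp add: w_def algebra_simps)
    also have "\<dots> = 2 * w\<^sup>2 + 2 * growth\<^sup>2 - (w - growth)\<^sup>2" by (simp add: power2_sum power2_diff)
    also have "\<dots> \<le> 2 * w\<^sup>2 + 2 * growth\<^sup>2" by simp
    finally have "\<bar>growth * N - k\<bar>\<^sup>2 \<le> 2 * w\<^sup>2 + 2 * growth\<^sup>2" .
    moreover have "0 \<le> (\<bar>d\<bar> - \<bar>growth * N - k\<bar>)\<^sup>2" by simp
    hence "2 * (\<bar>d\<bar> * \<bar>growth * N - k\<bar>) \<le> d\<^sup>2 + \<bar>growth * N - k\<bar>\<^sup>2" by (simp add: power2_diff)
    moreover have "0 \<le> \<bar>d\<bar> * \<bar>growth * N - k\<bar>" by simp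
    ultimately show "\<bar>d\<bar> * \<bar>growth * N - k\<bar> \<le> d\<^sup>2 + 2 * w\<^sup>2 + 2 * growth\<^sup>2" by linarith
  qed (use N g in auto)
  finally show ?thesis
    unfolding N_def[symmetric] r_def[symmetric] share d_def[symmetric] k_def[symmetric] w_def[symmetric]
    by simp
qed

lemma char_scaled_deviation_lim:
  assumes drift: "drift < 1 / 2"
  shows "(\<lambda>n. char (distr M borel (\<lambda>\<omega>. sqrt (real n) * (urn_proportion Y1 Y2 n \<omega> - 1 / 2))) t)
    \<longlonglongrightarrow> exp (- step_var * (t / (2 * growth))\<^sup>2 * (1 / (1 - 2 * drift)) / 2)"
proof -
  obtain V where V: "0 \<le> V"
    "\<And>n. (\<integral>\<omega>. (imbalance (colours n \<omega>))\<^sup>2 \<partial>M) \<le> V * (real n + 1)"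
    "\<And>n. (\<integral>\<omega>. (ball_count (colours n \<omega>) - growth * (real n + 1))\<^sup>2 \<partial>M) \<le> V * (real n + 1)"
    using second_moments[OF drift] by blast
  define X where "X n y = sqrt (real n) * (share y - 1 / 2)" for n and y :: "nat \<times> nat"
  \<comment> \<open>The 2 comes from Z - 1/2 = D / (2T) and \<open>growth\<close> from T being close
    to growth n; squared, they give the 4 growth^2 in the denominator of the limit variance.\<close>
  define s where "s = t / (2 * growth)"
  define B where "B n = \<bar>t\<bar> / (2 * growth * (real n * sqrt (real n)))" for n
  define \<phi> where "\<phi> n = char (distr M borel (\<lambda>\<omega>. sqrt (real n) * (urn_proportion Y1 Y2 n \<omega> - 1 / 2))) t" for n
  have \<phi>: "\<phi> n = (\<integral>\<omega>. iexp (t * X n (colours n \<omega>)) \<partial>M)" for n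
    unfolding \<phi>_def char_def X_def urn_proportion_eq
    by (subst integral_distr) auto
  have bound: "cmod (\<phi> n - imbalance_char n (s / sqrt (real n))) \<le>
      B n * (3 * V * (real n + 1) + 2 * growth\<^sup>2)" if n: "0 < n" for n
  proof -
    let ?f = "\<lambda>y. iexp (t * X n y)" and ?h = "\<lambda>y. iexp (s / sqrt (real n) * imbalance y)"
    define F where "F y = ?f y - ?h y" for y
    define G where "G y = B n * ((imbalance y)\<^sup>2 + 2 * (ball_count y - growth * (real n + 1))\<^sup>2 + 2 * growth\<^sup>2)" for y
    have "\<phi> n - imbalance_char n (s / sqrt (real n)) = (\<integral>\<omega>. F (colours n \<omega>) \<partial>M)"
      unfolding \<phi> imbalance_char_def F_def
      by (rule Bochner_Integration.integral_diff[OF integrable_colours[where f = ?f]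
            integrable_colours[where f = ?h], symmetric])
    hence "cmod (\<phi> n - imbalance_char n (s / sqrt (real n))) = cmod (\<integral>\<omega>. F (colours n \<omega>) \<partial>M)"
      by (rule arg_cong)
    also have "\<dots> \<le> (\<integral>\<omega>. cmod (F (colours n \<omega>)) \<partial>M)"
      by (rule integral_norm_bound)
    also have "\<dots> \<le> (\<integral>\<omega>. G (colours n \<omega>) \<partial>M)"
    proof (rule integral_mono_AE)
      show "AE \<omega> in M. cmod (F (colours n \<omega>)) \<le> G (colours n \<omega>)"
        using AE_total_colours_ge[of n] unfolding F_def G_def X_def s_def B_def
        by eventually_elim (rule order_trans[OF iexp_diff_le scaled_deviation_approx[OF n]])
    qed (rule integrable_colours[where f = "\<lambda>y. cmod (F y)"] integrable_colours[where f = G])+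
    also have "\<dots> = B n * ((\<integral>\<omega>. (imbalance (colours n \<omega>))\<^sup>2 \<partial>M) +
        2 * (\<integral>\<omega>. (ball_count (colours n \<omega>) - growth * (real n + 1))\<^sup>2 \<partial>M) + 2 * growth\<^sup>2)"
      unfolding G_def
      using integrable_colours[where f = "\<lambda>y. (imbalance y)\<^sup>2"]
        integrable_colours[where f = "\<lambda>y. (ball_count y - growth * (real n + 1))\<^sup>2"]
      by (simp add: prob_space)
    also have "\<dots> \<le> B n * (V * (real n + 1) + 2 * (V * (real n + 1)) + 2 * growth\<^sup>2)"
      using growth_pos by (intro mult_left_mono add_mono V order_refl) (auto simp: B_def)
    finally show ?thesis by (simp add: mult.assoc)
  qed
  have "(\<lambda>n. (real n + 1) / (real n * sqrt (real n))) \<longlonglongrightarrow> 0" "(\<lambda>n. 1 / (real n * sqrt (real n))) \<longlonglongrightarrow> 0"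
    by real_asymp+
  hence "(\<lambda>n. \<bar>t\<bar> / (2 * growth) * (3 * V * ((real n + 1) / (real n * sqrt (real n))) +
      2 * growth\<^sup>2 * (1 / (real n * sqrt (real n))))) \<longlonglongrightarrow> \<bar>t\<bar> / (2 * growth) * (3 * V * 0 + 2 * growth\<^sup>2 * 0)"
    by (intro tendsto_mult tendsto_add tendsto_const)
  hence lim0: "(\<lambda>n. \<bar>t\<bar> / (2 * growth) * (3 * V * ((real n + 1) / (real n * sqrt (real n))) +
      2 * growth\<^sup>2 * (1 / (real n * sqrt (real n))))) \<longlonglongrightarrow> 0"
    by (simp only: mult_zero_right add_0_right)
  have lim: "(\<lambda>n. B n * (3 * V * (real n + 1) + 2 * growth\<^sup>2)) \<longlonglongrightarrow> 0"
  proof -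
    have "k / (l * q) * (u * m + h) = k / l * (u * (m / q) + h * (1 / q))" for k l q u m h :: real
      by (simp add: distrib_left)
    with lim0 show ?thesis unfolding B_def by (simp only:)
  qed
  have "(\<lambda>n. \<phi> n - imbalance_char n (s / sqrt (real n))) \<longlonglongrightarrow> 0"
    by (rule Lim_null_comparison[OF _ lim]) (rule eventually_sequentiallyI[of 1], rule bound, simp)
  from Lim_transform[OF imbalance_char_lim[OF drift, of s] this]
  show ?thesis unfolding \<phi>_def s_def .
qed

end

theorem theorem3p3:
  fixes M :: "'a measure"
    and a b c y1 y2 :: nat and p :: real
    and \<xi> \<eta> Y1 Y2 :: "nat \<Rightarrow> 'a \<Rightarrow> nat"
    and \<sigma>2 \<Gamma> :: real
  assumes urn: "polya_friedman_urn M a b c p y1 y2 \<xi> \<eta> Y1 Y2"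
    and "y1 + y2 > 0"
    and "a > 0" and "b > 0" and "c > 0"
    and "0 < p" and "p < 1"
    and "3 * real b * p + real c * p > real a * p + real c"
  defines "\<sigma>2 \<equiv> (p * (real a - real b)\<^sup>2 + (real c)\<^sup>2 * (1 - p)) /
                   (4 * ((real a + real b) * p + real c * (1 - p))\<^sup>2)"
    and "\<Gamma> \<equiv> 2 * real b * p / ((real a + real b) * p + real c * (1 - p))"
  shows "weak_conv_m
           (\<lambda>n. distr M borel (\<lambda>\<omega>. sqrt (real n) * (urn_proportion Y1 Y2 n \<omega> - 1 / 2)))
           (density lborel (normal_density 0 (sqrt (\<sigma>2 / (2 * \<Gamma> - 1)))))"
proof -
  interpret positive_polya_friedman_urn M a b c p y1 y2 \<xi> \<eta> Y1 Y2
    using assms(1-7) by (auto simp: positive_polya_friedman_urn_def positive_polya_friedman_urn_axioms_def)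
  have \<Gamma>: "2 * \<Gamma> - 1 = 1 - 2 * drift"
  proof -
    have "2 * real b * p = growth - drift * growth"
      unfolding drift_growth unfolding growth_def by (simp add: algebra_simps)
    hence "\<Gamma> = (growth - drift * growth) / growth" unfolding \<Gamma>_def growth_def by simp
    thus ?thesis using growth_pos by (simp add: diff_divide_distrib)
  qed
  have \<sigma>2: "\<sigma>2 = step_var / (4 * growth\<^sup>2)"
    by (simp add: \<sigma>2_def step_var_def growth_def mult.commute)
  \<comment> \<open>The hypothesis on a, b, c, p is this inequality after expansion, that is, 2
    \<Gamma> - 1 > 0.\<close>
  have "2 * (drift * growth) < 1 * growth"
    using assms(8) unfolding drift_growth unfolding growth_def by (simp add: algebra_simps)
  hence drift: "drift < 1 / 2" using growth_pos by (simp flip: mult.assoc)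
  define s where "s = sqrt (\<sigma>2 / (2 * \<Gamma> - 1))"
  \<comment> \<open>\<open>normal_density\<close> takes a standard deviation and is a probability
    density only for a positive one. \<open>step_var\<close> is positive even when a = b, thanks to
    the Polya steps.\<close>
  have "0 < \<sigma>2 / (2 * \<Gamma> - 1)"
    unfolding \<Gamma> \<sigma>2 using drift growth_pos step_var_pos by (intro divide_pos_pos mult_pos_pos) auto
  hence s: "0 < s" "s\<^sup>2 = \<sigma>2 / (2 * \<Gamma> - 1)" by (simp_all add: s_def)
  show ?thesis unfolding s_def[symmetric]
  proof (rule levy_continuity)
    show "real_distribution (distr M borel (\<lambda>\<omega>. sqrt (real n) * (urn_proportion Y1 Y2 n \<omega> - 1 / 2)))" for n
      unfolding urn_proportion_eq by (intro real_distribution_distr) measurable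
    show "real_distribution (density lborel (normal_density 0 s))"
      using prob_space_normal_density[OF s(1)] by (simp add: real_distribution_def real_distribution_axioms_def)
    fix t
    have "- step_var * (t / (2 * growth))\<^sup>2 * (1 / (1 - 2 * drift)) / 2 = - (s * t)\<^sup>2 / 2"
      unfolding power_mult_distrib s(2) \<Gamma> \<sigma>2 by (simp add: power_divide power_mult_distrib)
    from char_scaled_deviation_lim[OF drift, of t, unfolded this]
    show "(\<lambda>n. char (distr M borel (\<lambda>\<omega>. sqrt (real n) * (urn_proportion Y1 Y2 n \<omega> - 1 / 2))) t)
        \<longlonglongrightarrow> char (density lborel (normal_density 0 s)) t"
      unfolding char_normal_density[OF s(1)] .
  qed
qed

end
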